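(* Let $\gamma=\gamma(n)$ with $0\le\gamma\le\frac14$ and $\gamma=\omega(n^{-1/2})$ as $n\to\infty$. There exists a polynomial-time algorithm which, given as input a tournament $T$ on $n$ vertices drawn from the planted model $\mathcal{P}$ with signal parameter $\gamma$, outputs a permutation $\hat\pi\in S_n$ that with high probability satisfies $$\mathrm{align}(\hat\pi,T)\ \ge\ (1-o(1))\cdot\max_{\tilde\pi\in S_n}\mathrm{align}(\tilde\pi,T).$$
   Context: A tournament on $n$ vertices is identified with its tournament matrix $T\in\{-1,0,1\}^{n\times n}$, which is skew-symmetric with zero diagonal and off-diagonal entries $T_{i,j}=-T_{j,i}\in\{\pm1\}$; $T_{i,j}=1$ means the edge between $i$ and $j$ is directed from $i$ to $j$. Planted model $\mathcal{P}$ with signal parameter $\gamma\in[0,\frac12]$: draw a hidden permutation $\pi$ uniformly from the symmetric group $S_n$; conditionally on $\pi$, independently for each pair $i,j$ with $\pi(i)<\pi(j)$, set $T_{i,j}=-T_{j,i}=+1$ with probability $\frac12+\gamma$ and $-1$ with probability $\frac12-\gamma$. Alignment objective: for $\rho\in S_n$, $$\mathrm{align}(\rho,T)=\sum_{(i,j):\,T_{i,j}=1}\left(\mathbf{1}\{\rho(i)<\rho(j)\}-\mathbf{1}\{\rho(i)>\rho(j)\}\right).$$ "With high probability" means with probability $1-o(1)$ as $n\to\infty$. *)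

theory Defs
  imports
    "HOL-Probability.Probability"
    "HOL-Library.Landau_Symbols"
    "HOL-Combinatorics.Permutations"
    "Jordan_Normal_Form.Matrix"
begin

section \<open>Tournaments, the planted model and the alignment objective\<close>

text \<open>Vertices are numbered from 0: the vertex set is \<open>{..<n}\<close>, and the symmetric group
  on it is \<open>{\<rho>. \<rho> permutes {..<n}}\<close>.\<close>

definition tournament :: "nat \<Rightarrow> int mat \<Rightarrow> bool" where
  "tournament n T \<longleftrightarrow> T \<in> carrier_mat n n \<and>
     (\<forall>i<n. T $$ (i, i) = 0) \<and>
     (\<forall>i<n. \<forall>j<n. i \<noteq> j \<longrightarrow> T $$ (i, j) \<in> {-1, 1} \<and> T $$ (i, j) = - T $$ (j, i))"

text \<open>There is one coin \<open>s (i, j)\<close> for each pair with \<open>\<pi> i < \<pi> j\<close>; it shows whether the edge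
  between \<open>i\<close> and \<open>j\<close> agrees with \<open>\<pi>\<close>. Only the tournament is returned, \<open>\<pi>\<close> stays hidden.\<close>

definition planted_model :: "nat \<Rightarrow> real \<Rightarrow> int mat pmf" where
  "planted_model n \<gamma> = do {
     \<pi> \<leftarrow> pmf_of_set {\<pi>. \<pi> permutes {..<n}};
     s \<leftarrow> Pi_pmf {(i, j). i < n \<and> j < n \<and> \<pi> i < \<pi> j} False (\<lambda>_. bernoulli_pmf (1/2 + \<gamma>));
     return_pmf (mat n n (\<lambda>(i, j).
       if \<pi> i < \<pi> j then (if s (i, j) then 1 else -1)
       else if \<pi> j < \<pi> i then (if s (j, i) then -1 else 1)
       else 0))
   }"

definition align :: "(nat \<Rightarrow> nat) \<Rightarrow> int mat \<Rightarrow> int" where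
  "align \<rho> T = (\<Sum>(i, j) \<in> {(i, j). i < dim_row T \<and> j < dim_col T \<and> T $$ (i, j) = 1}.
     of_bool (\<rho> i < \<rho> j) - of_bool (\<rho> i > \<rho> j))"

section \<open>Polynomial-time algorithms\<close>

text \<open>The machine model is the (deterministic) random access machine with unit cost per
  instruction, whose only arithmetic is addition and subtraction. Within \<open>t\<close> steps such a machine
  produces only numbers of \<open>O(t)\<close> bits beyond the size of the input, so polynomial time
  on it is the same as polynomial time on a Turing machine; with multiplication at unit cost this
  would fail. Registers are named by the program and hence finite in number; memory is addressed
  indirectly, through the content of a register. Addresses are integers, so that no convention for
  negative addresses is needed.\<close>

datatype instr =
    SetConst nat int    \<comment> \<open>\<open>R[r] := c\<close>\<close>
  | Add nat nat nat     \<comment> \<open>\<open>R[r] := R[a] + R[b]\<close>\<close>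
  | Sub nat nat nat     \<comment> \<open>\<open>R[r] := R[a] - R[b]\<close>\<close>
  | Load nat nat        \<comment> \<open>\<open>R[r] := M[R[a]]\<close>\<close>
  | Store nat nat       \<comment> \<open>\<open>M[R[a]] := R[r]\<close>\<close>
  | JumpPos nat nat     \<comment> \<open>if \<open>R[r] > 0\<close> then go to instruction \<open>l\<close>\<close>

text \<open>A configuration consists of program counter, registers and memory.\<close>

type_synonym config = "nat \<times> (nat \<Rightarrow> int) \<times> (int \<Rightarrow> int)"

fun exec_instr :: "instr \<Rightarrow> config \<Rightarrow> config" where
  "exec_instr (SetConst r c) (pc, R, M) = (pc + 1, R(r := c), M)"
| "exec_instr (Add r a b) (pc, R, M) = (pc + 1, R(r := R a + R b), M)"
| "exec_instr (Sub r a b) (pc, R, M) = (pc + 1, R(r := R a - R b), M)"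
| "exec_instr (Load r a) (pc, R, M) = (pc + 1, R(r := M (R a)), M)"
| "exec_instr (Store r a) (pc, R, M) = (pc + 1, R, M(R a := R r))"
| "exec_instr (JumpPos r l) (pc, R, M) = (if R r > 0 then l else pc + 1, R, M)"

text \<open>The machine halts when the program counter leaves the program.\<close>

definition halted :: "instr list \<Rightarrow> config \<Rightarrow> bool" where
  "halted P c \<longleftrightarrow> fst c \<ge> length P"

definition step :: "instr list \<Rightarrow> config \<Rightarrow> config" where
  "step P c = (if halted P c then c else exec_instr (P ! fst c) c)"

definition initial_config :: "int list \<Rightarrow> config" where
  "initial_config xs =
     (0, \<lambda>_. 0, \<lambda>a. if 0 \<le> a \<and> a < int (length xs) then xs ! nat a else 0)"

text \<open>Halted configurations are fixed by \<open>step\<close>, so the following says that the machine halts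
  after at most \<open>t\<close> steps, with \<open>ys\<close> in the memory cells from address 0 on.\<close>

definition computes_within :: "instr list \<Rightarrow> int list \<Rightarrow> nat \<Rightarrow> int list \<Rightarrow> bool" where
  "computes_within P xs t ys \<longleftrightarrow>
     (\<exists>pc R M. (step P ^^ t) (initial_config xs) = (pc, R, M) \<and> halted P (pc, R, M) \<and>
       (\<forall>i<length ys. M (int i) = ys ! i))"

text \<open>The input is the number of vertices followed by the rows of the tournament matrix.\<close>

definition encode_tournament :: "int mat \<Rightarrow> int list" where
  "encode_tournament T =
     int (dim_row T) # concat (map (\<lambda>i. map (\<lambda>j. T $$ (i, j)) [0..<dim_col T]) [0..<dim_row T])"

definition encode_perm :: "nat \<Rightarrow> (nat \<Rightarrow> nat) \<Rightarrow> int list" where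
  "encode_perm n \<rho> = map (\<lambda>i. int (\<rho> i)) [0..<n]"

text \<open>One program has to serve all \<open>n\<close>, and all tournaments on \<open>n\<close> vertices. As the input consists of
  \<open>n\<^sup>2 + 1\<close> numbers of absolute value at most \<open>max n 1\<close>, a polynomial in \<open>n\<close> is the same as
  a polynomial in the length of the input.\<close>

definition poly_time_algorithm :: "(int mat \<Rightarrow> nat \<Rightarrow> nat) \<Rightarrow> bool" where
  "poly_time_algorithm A \<longleftrightarrow>
     (\<forall>n T. tournament n T \<longrightarrow> A T permutes {..<n}) \<and>
     (\<exists>P c k. \<forall>n T. tournament n T \<longrightarrow>
        computes_within P (encode_tournament T) (c * n ^ k + c) (encode_perm n (A T)))"

end

theory Submission
  imports Defs "HOL-Real_Asymp.Real_Asymp"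
begin

text \<open>
  The algorithm sorts the vertices by score, that is, by the number of vertices they beat.

  Fix \<open>\<pi>\<close> and write the sign of the edge \<open>e\<close> (oriented along \<open>\<pi>\<close>) as \<open>2 \<gamma>\<close> plus noise. Two uniform bounds
  on the noise, both from Hoeffding's inequality and a union bound, hold up to probability
  \<open>O(n e\<^sup>-\<^sup>n)\<close>. First, over all vertex sets \<open>B\<close>, the noise in the total score of \<open>B\<close> is at most
  \<open>2 n\<^sup>3\<^sup>/\<^sup>2\<close>. Second, over all orderings, the noise in the alignment is \<open>O(n\<^sup>3\<^sup>/\<^sup>2)\<close>. A union
  bound over the \<open>n!\<close> orderings would lose a factor \<open>\<surd>ln n\<close>; chaining over binary scales avoids this:
  at scale \<open>2\<^sup>m\<close> there are only \<open>n 2\<^sup>m\<close> relevant pairs and \<open>(1 + n / 2\<^sup>m)\<^sup>n\<close> configurations, so that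
  the bounds of all scales form a geometric series.

  With \<open>x = \<gamma> \<surd>n \<rightarrow> \<infinity>\<close>, the second bound limits the optimum to \<open>2 \<gamma> (n choose 2) + O(\<gamma> n\<^sup>2 / x)\<close>. By the
  first bound only \<open>O(n / \<surd>x)\<close> vertices have a score off by more than \<open>2 \<gamma> n / \<surd>x\<close>, so sorting by score
  inverts \<open>O(n\<^sup>2 / \<surd>x)\<close> pairs and its alignment is \<open>2 \<gamma> (n choose 2) - O(\<gamma> n\<^sup>2 / \<surd>x)\<close>.
\<close>

section \<open>Runs of the random access machine\<close>

text \<open>The number of steps is only bounded, because the branches of a loop body differ in
  length. Upper bounds compose without reference to the branches taken.\<close>

definition reaches :: "instr list \<Rightarrow> nat \<Rightarrow> config \<Rightarrow> (config \<Rightarrow> bool) \<Rightarrow> bool" where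
  "reaches P t c Q \<longleftrightarrow> (\<exists>s\<le>t. Q ((step P ^^ s) c))"

lemma reachesI: "Q c \<Longrightarrow> reaches P t c Q"
  unfolding reaches_def by (intro exI[of _ 0]) auto

lemma reaches_exact: "Q ((step P ^^ s) c) \<Longrightarrow> s \<le> t \<Longrightarrow> reaches P t c Q"
  unfolding reaches_def by blast

lemma reaches_trans:
  assumes "reaches P s c Q" and "\<And>c'. Q c' \<Longrightarrow> reaches P t c' Q'"
  shows "reaches P (s + t) c Q'"
proof -
  obtain a where a: "a \<le> s" "Q ((step P ^^ a) c)"
    using assms(1) unfolding reaches_def by auto
  obtain b where b: "b \<le> t" "Q' ((step P ^^ b) ((step P ^^ a) c))"
    using assms(2)[OF a(2)] unfolding reaches_def by auto
  have "(step P ^^ b) ((step P ^^ a) c) = (step P ^^ (a + b)) c"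
    by (simp add: add.commute[of a b] funpow_add)
  with a b show ?thesis
    unfolding reaches_def by (intro exI[of _ "a + b"]) auto
qed

lemma reaches_mono: "reaches P s c Q \<Longrightarrow> s \<le> t \<Longrightarrow> (\<And>c'. Q c' \<Longrightarrow> Q' c') \<Longrightarrow> reaches P t c Q'"
  unfolding reaches_def by (meson le_trans)

lemma reaches_loop:
  assumes "\<And>k c. k < n \<Longrightarrow> Inv k c \<Longrightarrow> reaches P t c (Inv (Suc k))"
  shows "Inv 0 c \<Longrightarrow> reaches P (n * t) c (Inv n)"
  using assms
proof (induction n)
  case 0
  then show ?case by (simp add: reachesI)
next
  case (Suc n)
  have "reaches P (n * t + t) c (Inv (Suc n))"
    by (rule reaches_trans[where Q = "Inv n"]) (use Suc in auto)
  then show ?case by (simp add: add.commute)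
qed

text \<open>The run may reach its goal before time \<open>t\<close>. A halted configuration is a
  fixed point of \<open>step\<close>, so the remaining \<open>t - s\<close> steps change
  nothing.\<close>

lemma computes_withinI:
  assumes "reaches P t (initial_config xs)
    (\<lambda>(pc, R, M). length P \<le> pc \<and> (\<forall>i<length ys. M (int i) = ys ! i))"
  shows "computes_within P xs t ys"
proof -
  obtain s where s: "s \<le> t" "case (step P ^^ s) (initial_config xs) of
      (pc, R, M) \<Rightarrow> length P \<le> pc \<and> (\<forall>i<length ys. M (int i) = ys ! i)"
    using assms unfolding reaches_def by (elim exE conjE)
  obtain pc R M where c: "(step P ^^ s) (initial_config xs) = (pc, R, M)"
    by (rule prod_cases3)
  have h: "halted P (pc, R, M)" using s(2) by (simp add: c halted_def)
  have fixed: "(step P ^^ r) (pc, R, M) = (pc, R, M)" for r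
    by (induction r) (simp_all add: step_def h)
  have "(step P ^^ (t - s + s)) (initial_config xs) = (pc, R, M)"
    unfolding funpow_add comp_apply c by (rule fixed)
  then have "(step P ^^ t) (initial_config xs) = (pc, R, M)" using s(1) by simp
  moreover have "\<forall>i<length ys. M (int i) = ys ! i" using s(2) by (simp add: c)
  ultimately show ?thesis
    using h unfolding computes_within_def by (intro exI conjI)
qed

section \<open>Ranking by score\<close>

text \<open>The dominant part counts the vertices that \<open>i\<close> does not beat. It includes \<open>i\<close> itself, which
  shifts all keys alike and spares the program a test. The summand \<open>i\<close> breaks ties.\<close>

definition key :: "int mat \<Rightarrow> nat \<Rightarrow> int" where
  "key T i = int (dim_row T) * (\<Sum>j<dim_row T. of_bool (T $$ (i, j) \<le> 0)) + int i"

text \<open>A vertex that beats many others has a small key and comes early. Counting smaller keys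
  amounts to two nested loops, with no rearrangement of memory. Outside the vertex set the function
  is the identity, as \<open>permutes\<close> demands.\<close>

definition rank_alg :: "int mat \<Rightarrow> nat \<Rightarrow> nat" where
  "rank_alg T i = (if i < dim_row T then card {j. j < dim_row T \<and> key T j < key T i} else i)"

text \<open>\<open>R[0]\<close> holds \<open>n\<close>, \<open>R[8]\<close> stays 0, and
  \<open>R[1]\<close> stays 1, so that \<open>JumpPos 1\<close> is an unconditional jump. In the
  first phase \<open>R[3]\<close> walks through the matrix in row-major order, and
  \<open>R[4]\<close> starts at \<open>i\<close> and gains \<open>n\<close> for each entry that is
  not positive; hence neither addresses nor keys require multiplication. The keys lie at negative
  addresses and survive when the ranks overwrite the input. In the second phase \<open>R[9]\<close>
  and \<open>R[7]\<close> point to the keys of \<open>i\<close> and \<open>j\<close>.\<close>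

definition rank_prog :: "instr list" where
  "rank_prog =
   [SetConst 1 1, Load 0 8, SetConst 3 1,
    \<comment> \<open>3: store \<open>key T i\<close> at address \<open>- 1 - i\<close> for all \<open>i = R[2]\<close>\<close>
    Sub 5 0 2, JumpPos 5 6, JumpPos 1 21,
    Add 4 2 8, SetConst 6 0,
    \<comment> \<open>8: loop over \<open>j = R[6]\<close>\<close>
    Sub 5 0 6, JumpPos 5 11, JumpPos 1 17,
    Load 5 3, JumpPos 5 14, Add 4 4 0, Add 3 3 1, Add 6 6 1, JumpPos 1 8,
    Sub 7 7 1, Store 4 7, Add 2 2 1, JumpPos 1 3,
    SetConst 2 0, SetConst 9 0,
    \<comment> \<open>23: store the rank at address \<open>i\<close> for all \<open>i = R[2]\<close>, over the input\<close>
    Sub 5 0 2, JumpPos 5 26, JumpPos 1 45,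
    Sub 9 9 1, Load 10 9, SetConst 4 0, SetConst 6 0, SetConst 7 0,
    \<comment> \<open>31: loop over \<open>j = R[6]\<close>\<close>
    Sub 5 0 6, JumpPos 5 34, JumpPos 1 42,
    Sub 7 7 1, Load 5 7, Sub 5 10 5, JumpPos 5 39, JumpPos 1 40, Add 4 4 1,
    Add 6 6 1, JumpPos 1 31,
    Store 4 2, Add 2 2 1, JumpPos 1 23]"

lemma length_rank_prog: "length rank_prog = 45"
  by (simp add: rank_prog_def)

section \<open>Correctness and running time of the ranking program\<close>

lemma step_rank_prog:
  "pc < 45 \<Longrightarrow> step rank_prog (pc, R, M) = exec_instr (rank_prog ! pc) (pc, R, M)"
  by (simp add: step_def halted_def length_rank_prog)

lemma rank_prog_nth:
  "rank_prog ! 0 = SetConst 1 1"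
  "rank_prog ! Suc 0 = Load 0 8"
  "rank_prog ! Suc (Suc 0) = SetConst 3 1"
  "rank_prog ! 3 = Sub 5 0 2"
  "rank_prog ! 4 = JumpPos 5 6"
  "rank_prog ! 5 = JumpPos 1 21"
  "rank_prog ! 6 = Add 4 2 8"
  "rank_prog ! 7 = SetConst 6 0"
  "rank_prog ! 8 = Sub 5 0 6"
  "rank_prog ! 9 = JumpPos 5 11"
  "rank_prog ! 10 = JumpPos 1 17"
  "rank_prog ! 11 = Load 5 3"
  "rank_prog ! 12 = JumpPos 5 14"
  "rank_prog ! 13 = Add 4 4 0"
  "rank_prog ! 14 = Add 3 3 1"
  "rank_prog ! 15 = Add 6 6 1"
  "rank_prog ! 16 = JumpPos 1 8"
  "rank_prog ! 17 = Sub 7 7 1"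
  "rank_prog ! 18 = Store 4 7"
  "rank_prog ! 19 = Add 2 2 1"
  "rank_prog ! 20 = JumpPos 1 3"
  "rank_prog ! 21 = SetConst 2 0"
  "rank_prog ! 22 = SetConst 9 0"
  "rank_prog ! 23 = Sub 5 0 2"
  "rank_prog ! 24 = JumpPos 5 26"
  "rank_prog ! 25 = JumpPos 1 45"
  "rank_prog ! 26 = Sub 9 9 1"
  "rank_prog ! 27 = Load 10 9"
  "rank_prog ! 28 = SetConst 4 0"
  "rank_prog ! 29 = SetConst 6 0"
  "rank_prog ! 30 = SetConst 7 0"
  "rank_prog ! 31 = Sub 5 0 6"
  "rank_prog ! 32 = JumpPos 5 34"
  "rank_prog ! 33 = JumpPos 1 42"
  "rank_prog ! 34 = Sub 7 7 1"
  "rank_prog ! 35 = Load 5 7"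
  "rank_prog ! 36 = Sub 5 10 5"
  "rank_prog ! 37 = JumpPos 5 39"
  "rank_prog ! 38 = JumpPos 1 40"
  "rank_prog ! 39 = Add 4 4 1"
  "rank_prog ! 40 = Add 6 6 1"
  "rank_prog ! 41 = JumpPos 1 31"
  "rank_prog ! 42 = Store 4 2"
  "rank_prog ! 43 = Add 2 2 1"
  "rank_prog ! 44 = JumpPos 1 23"
  by (simp_all add: rank_prog_def)

text \<open>Peels off the first step rather than the last, so that the simplifier executes a stretch
  of the program symbolically from its initial configuration.\<close>

lemma funpow_step_numeral:
  "(step P ^^ numeral k) c = (step P ^^ pred_numeral k) (step P c)"
  by (simp add: numeral_eq_Suc funpow_Suc_right del: funpow.simps)

lemmas run_simps = step_rank_prog rank_prog_nth funpow_step_numeral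

locale rank_run =
  fixes T :: "int mat" and n :: nat
  assumes dim: "T \<in> carrier_mat n n"
begin

definition input_ok :: "(int \<Rightarrow> int) \<Rightarrow> bool" where
  "input_ok M \<longleftrightarrow> (\<forall>i<n. \<forall>j<n. M (1 + int (i * n + j)) = T $$ (i, j))"

definition keys_ok :: "nat \<Rightarrow> (int \<Rightarrow> int) \<Rightarrow> bool" where
  "keys_ok k M \<longleftrightarrow> (\<forall>i<k. M (- int i - 1) = key T i)"

text \<open>The four loop invariants describe the machine at the loop heads, which are the
  instructions 3, 8, 23 and 31.\<close>

definition key_outer :: "nat \<Rightarrow> config \<Rightarrow> bool" where
  "key_outer i = (\<lambda>(pc, R, M). pc = 3 \<and> R 0 = int n \<and> R 1 = 1 \<and> R 8 = 0 \<and> R 2 = int i \<and>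
     R 3 = 1 + int (i * n) \<and> R 7 = - int i \<and> input_ok M \<and> keys_ok i M)"

definition key_inner :: "nat \<Rightarrow> nat \<Rightarrow> config \<Rightarrow> bool" where
  "key_inner i j = (\<lambda>(pc, R, M). pc = 8 \<and> R 0 = int n \<and> R 1 = 1 \<and> R 8 = 0 \<and> R 2 = int i \<and>
     R 3 = 1 + int (i * n + j) \<and> R 7 = - int i \<and> input_ok M \<and> keys_ok i M \<and> R 6 = int j \<and>
     R 4 = int n * (\<Sum>j'<j. of_bool (T $$ (i, j') \<le> 0)) + int i)"

text \<open>The ranks are written over the input, so from here on only the keys, at negative
  addresses, are preserved.\<close>

definition rank_outer :: "nat \<Rightarrow> config \<Rightarrow> bool" where
  "rank_outer i = (\<lambda>(pc, R, M). pc = 23 \<and> R 0 = int n \<and> R 1 = 1 \<and> R 2 = int i \<and>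
     R 9 = - int i \<and> keys_ok n M \<and> (\<forall>i'<i. M (int i') = int (rank_alg T i')))"

definition rank_inner :: "nat \<Rightarrow> nat \<Rightarrow> config \<Rightarrow> bool" where
  "rank_inner i j = (\<lambda>(pc, R, M). pc = 31 \<and> R 0 = int n \<and> R 1 = 1 \<and> R 2 = int i \<and>
     R 9 = - int i - 1 \<and> keys_ok n M \<and> (\<forall>i'<i. M (int i') = int (rank_alg T i')) \<and>
     R 10 = key T i \<and> R 7 = - int j \<and> R 6 = int j \<and>
     R 4 = int (card {j'. j' < j \<and> key T j' < key T i}))"

lemma key_inner_step:
  assumes "i < n" "j < n" "key_inner i j c"
  shows "reaches rank_prog 8 c (key_inner i (Suc j))"
proof -
  obtain R M where c: "c = (8, R, M)" using assms(3) by (auto simp: key_inner_def)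
  have M: "M (1 + int (i * n + j)) = T $$ (i, j)"
    using assms by (auto simp: key_inner_def input_ok_def c)
  show ?thesis
  proof (cases "T $$ (i, j) \<le> 0")
    case True
    then have "key_inner i (Suc j) ((step rank_prog ^^ 8) c)"
      using assms M by (simp add: run_simps c key_inner_def algebra_simps)
    then show ?thesis by (rule reaches_exact) simp
  next
    case False
    then have "key_inner i (Suc j) ((step rank_prog ^^ 7) c)"
      using assms M by (simp add: run_simps c key_inner_def algebra_simps)
    then show ?thesis by (rule reaches_exact) simp
  qed
qed

lemma key_outer_step:
  assumes "i < n" "key_outer i c"
  shows "reaches rank_prog (8 * n + 12) c (key_outer (Suc i))"
proof -
  obtain R M where c: "c = (3, R, M)" using assms(2) by (auto simp: key_outer_def)
  have "key_inner i 0 ((step rank_prog ^^ 4) c)"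
    using assms by (simp add: run_simps c key_inner_def key_outer_def)
  then have start: "reaches rank_prog 4 c (key_inner i 0)" by (rule reaches_exact) simp
  have loop: "reaches rank_prog (n * 8) c' (key_inner i n)" if "key_inner i 0 c'" for c'
    using that by (rule reaches_loop[rotated]) (rule key_inner_step[OF assms(1)])
  have fin: "reaches rank_prog 7 c' (key_outer (Suc i))" if inv: "key_inner i n c'" for c'
  proof -
    obtain R M where c': "c' = (8, R, M)" using inv by (auto simp: key_inner_def)
    have inp: "input_ok (M(- int i - 1 := x))" if "input_ok M" for x
    proof -
      have "1 + int (a * n + b) \<noteq> - int i - 1" for a b by linarith
      then show ?thesis using that unfolding input_ok_def by (simp del: of_nat_add of_nat_mult)
    qed
    have keys: "keys_ok (Suc i) (M(- int i - 1 := key T i))" if "keys_ok i M"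
      using that by (auto simp: keys_ok_def less_Suc_eq)
    have key: "int n * (\<Sum>j'<n. of_bool (T $$ (i, j') \<le> 0)) + int i = key T i"
      using dim by (simp add: key_def)
    have "key_outer (Suc i) ((step rank_prog ^^ 7) c')"
      using inv inp keys key unfolding c' key_inner_def
      by (simp add: run_simps key_outer_def del: sum_of_bool_eq)
    then show ?thesis by (rule reaches_exact) simp
  qed
  have "reaches rank_prog (4 + (n * 8 + 7)) c (key_outer (Suc i))"
    by (intro reaches_trans[OF start] reaches_trans[OF loop] fin)
  then show ?thesis by (rule reaches_mono) auto
qed

lemma rank_inner_step:
  assumes "i < n" "j < n" "rank_inner i j c"
  shows "reaches rank_prog 9 c (rank_inner i (Suc j))"
proof -
  obtain R M where c: "c = (31, R, M)" using assms(3) by (auto simp: rank_inner_def)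
  have M: "M (- int j - 1) = key T j"
    using assms by (auto simp: rank_inner_def keys_ok_def c)
  have set: "{j'. j' < Suc j \<and> key T j' < key T i} =
      (if key T j < key T i then insert j {j'. j' < j \<and> key T j' < key T i}
       else {j'. j' < j \<and> key T j' < key T i})"
    by (auto simp: less_Suc_eq)
  show ?thesis
  proof (cases "key T j < key T i")
    case True
    then have "rank_inner i (Suc j) ((step rank_prog ^^ 9) c)"
      using assms M set by (simp add: run_simps c rank_inner_def)
    then show ?thesis by (rule reaches_exact) simp
  next
    case False
    then have "rank_inner i (Suc j) ((step rank_prog ^^ 9) c)"
      using assms M set by (simp add: run_simps c rank_inner_def)
    then show ?thesis by (rule reaches_exact) simp
  qed
qed

lemma all_less_Suc: "(\<forall>i<Suc k. P i) \<longleftrightarrow> P k \<and> (\<forall>i<k. P i)"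
  using less_Suc_eq by auto

lemma rank_outer_step:
  assumes "i < n" "rank_outer i c"
  shows "reaches rank_prog (9 * n + 13) c (rank_outer (Suc i))"
proof -
  obtain R M where c: "c = (23, R, M)" using assms(2) by (auto simp: rank_outer_def)
  have M: "M (- int i - 1) = key T i"
    using assms by (auto simp: rank_outer_def keys_ok_def c)
  have "rank_inner i 0 ((step rank_prog ^^ 7) c)"
    using assms M by (simp add: run_simps c rank_inner_def rank_outer_def)
  then have start: "reaches rank_prog 7 c (rank_inner i 0)" by (rule reaches_exact) simp
  have loop: "reaches rank_prog (n * 9) c' (rank_inner i n)" if "rank_inner i 0 c'" for c'
    using that by (rule reaches_loop[rotated]) (rule rank_inner_step[OF assms(1)])
  have fin: "reaches rank_prog 6 c' (rank_outer (Suc i))" if inv: "rank_inner i n c'" for c'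
  proof -
    obtain R M where c': "c' = (31, R, M)" using inv by (auto simp: rank_inner_def)
    have keys: "keys_ok n (M(int i := x))" if "keys_ok n M" for x
      using that by (auto simp: keys_ok_def)
    have rank: "card {j'. j' < n \<and> key T j' < key T i} = rank_alg T i"
      using dim assms(1) by (simp add: rank_alg_def)
    have "rank_outer (Suc i) ((step rank_prog ^^ 6) c')"
      using inv keys unfolding c' rank_inner_def
      by (simp add: run_simps rank_outer_def rank all_less_Suc)
    then show ?thesis by (rule reaches_exact) simp
  qed
  have "reaches rank_prog (7 + (n * 9 + 6)) c (rank_outer (Suc i))"
    by (intro reaches_trans[OF start] reaches_trans[OF loop] fin)
  then show ?thesis by (rule reaches_mono) auto
qed

lemma rank_prog_reaches:
  assumes "M 0 = int n" "input_ok M"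
  shows "reaches rank_prog (17 * n\<^sup>2 + 25 * n + 11) (0, \<lambda>_. 0, M)
    (\<lambda>(pc, R, M). length rank_prog \<le> pc \<and> (\<forall>i<n. M (int i) = int (rank_alg T i)))"
    (is "reaches _ _ ?c ?Q")
proof -
  have "key_outer 0 ((step rank_prog ^^ 3) ?c)"
    using assms by (simp add: run_simps key_outer_def keys_ok_def)
  then have a: "reaches rank_prog 3 ?c (key_outer 0)" by (rule reaches_exact) simp
  have b: "reaches rank_prog (n * (8 * n + 12)) c' (key_outer n)" if "key_outer 0 c'" for c'
    using that by (rule reaches_loop[rotated]) (rule key_outer_step)
  have c: "reaches rank_prog 5 c' (rank_outer 0)" if inv: "key_outer n c'" for c'
  proof -
    obtain R M where c': "c' = (3, R, M)" using inv by (auto simp: key_outer_def)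
    have "rank_outer 0 ((step rank_prog ^^ 5) c')"
      using inv unfolding c' by (simp add: run_simps key_outer_def rank_outer_def)
    then show ?thesis by (rule reaches_exact) simp
  qed
  have d: "reaches rank_prog (n * (9 * n + 13)) c' (rank_outer n)" if "rank_outer 0 c'" for c'
    using that by (rule reaches_loop[rotated]) (rule rank_outer_step)
  have e: "reaches rank_prog 3 c' ?Q" if inv: "rank_outer n c'" for c'
  proof -
    obtain R M where c': "c' = (23, R, M)" using inv by (auto simp: rank_outer_def)
    have "?Q ((step rank_prog ^^ 3) c')"
      using inv length_rank_prog unfolding c' by (simp add: run_simps rank_outer_def)
    then show ?thesis by (rule reaches_exact) simp
  qed
  have "reaches rank_prog (3 + (n * (8 * n + 12) + (5 + (n * (9 * n + 13) + 3)))) ?c ?Q"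
    by (intro reaches_trans[OF a] reaches_trans[OF b] reaches_trans[OF c] reaches_trans[OF d] e)
  then show ?thesis by (rule reaches_mono) (auto simp: algebra_simps power2_eq_square)
qed

end

section \<open>Input layout, the ranking as a permutation, and polynomial time\<close>

lemma concat_rows_nth:
  assumes "i < m" "j < n"
  shows "concat (map (\<lambda>i. map (f i) [0..<n]) [0..<m]) ! (i * n + j) = f i j"
  using assms(1)
proof (induction m)
  case (Suc m)
  let ?rows = "concat (map (\<lambda>i. map (f i) [0..<n]) [0..<m])"
  have len: "length ?rows = m * n" by (simp add: length_concat o_def sum_list_triv)
  show ?case
  proof (cases "i = m")
    case True
    then show ?thesis using assms(2) len by (simp add: nth_append)
  next
    case False
    then have "i < m" using Suc.prems by simp
    then have "i * n + j < m * n"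
      using assms(2) mult_le_mono1[of "Suc i" m n] by simp
    then show ?thesis using Suc.IH[OF \<open>i < m\<close>] len by (simp add: nth_append)
  qed
qed simp

text \<open>The tie-breaking summand is the residue of the key modulo \<open>n\<close>, so distinct
  vertices have distinct keys. The number of smaller keys is then strictly monotone in the key,
  hence injective, and it is below \<open>n\<close> because no key is smaller than itself.\<close>

lemma rank_alg_permutes:
  assumes "dim_row T = n"
  shows "rank_alg T permutes {..<n}"
proof -
  have inj: "i = j" if "i < n" "j < n" "key T i = key T j" for i j
  proof -
    define a b where "a = (\<Sum>k<n. of_bool (T $$ (i, k) \<le> 0) :: int)"
      and "b = (\<Sum>k<n. of_bool (T $$ (j, k) \<le> 0) :: int)"
    have "int n * a + int i = int n * b + int j"
      using that(3) assms unfolding key_def a_def b_def by simp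
    then have "(int n * a + int i) mod int n = (int n * b + int j) mod int n" by simp
    then show ?thesis using that by simp
  qed
  have less: "rank_alg T i < rank_alg T j" if "i < n" "j < n" "key T i < key T j" for i j
    using that assms unfolding rank_alg_def by (auto intro!: psubset_card_mono)
  have "inj_on (rank_alg T) {..<n}"
  proof (rule inj_onI)
    fix i j assume *: "i \<in> {..<n}" "j \<in> {..<n}" "rank_alg T i = rank_alg T j"
    then have "key T i = key T j"
      using less[of i j] less[of j i] by (metis lessThan_iff less_irrefl linorder_neqE)
    then show "i = j" using inj * by simp
  qed
  moreover have "rank_alg T ` {..<n} \<subseteq> {..<n}"
  proof safe
    fix i assume i: "i < n"
    have "{j. j < n \<and> key T j < key T i} \<subset> {..<n}" using i by auto
    then have "card {j. j < n \<and> key T j < key T i} < card {..<n}"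
      by (intro psubset_card_mono) auto
    then show "rank_alg T i < n" using i assms by (simp add: rank_alg_def)
  qed
  ultimately have "bij_betw (rank_alg T) {..<n} {..<n}"
    by (simp add: bij_betw_def endo_inj_surj)
  then show ?thesis
    by (rule bij_imp_permutes) (simp add: rank_alg_def assms)
qed

text \<open>A difference of one between the counts changes the key by \<open>n\<close>, which
  outweighs the tie-breaking summands. Apart from being a permutation, this is all that the analysis
  of the alignment uses about the ranking.\<close>

lemma rank_alg_less_imp:
  assumes "dim_row T = n" "i < n" "j < n" "rank_alg T j < rank_alg T i"
  shows "(\<Sum>k<n. of_bool (T $$ (j, k) \<le> 0) :: int) \<le> (\<Sum>k<n. of_bool (T $$ (i, k) \<le> 0))"
proof (rule ccontr)
  define a b where "a = (\<Sum>k<n. of_bool (T $$ (i, k) \<le> 0) :: int)"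
    and "b = (\<Sum>k<n. of_bool (T $$ (j, k) \<le> 0) :: int)"
  assume "\<not> ?thesis"
  then have "a + 1 \<le> b" unfolding a_def b_def by simp
  then have "int n * (a + 1) \<le> int n * b" by (intro mult_left_mono) auto
  then have "key T i < key T j"
    using assms unfolding key_def a_def[symmetric] b_def[symmetric]
    by (simp add: algebra_simps a_def[symmetric] b_def[symmetric] del: sum_of_bool_eq)
  then have "card {k. k < n \<and> key T k < key T i} \<le> card {k. k < n \<and> key T k < key T j}"
    by (intro card_mono) auto
  then have "rank_alg T i \<le> rank_alg T j"
    using assms by (simp add: rank_alg_def)
  then show False using assms(4) by simp
qed

lemma poly_time_rank_alg: "poly_time_algorithm rank_alg"
  unfolding poly_time_algorithm_def
proof (intro conjI allI impI)
  show "rank_alg T permutes {..<n}" if "tournament n T" for n T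
    using that by (intro rank_alg_permutes) (auto simp: tournament_def)
next
  show "\<exists>P c k. \<forall>n T. tournament n T \<longrightarrow>
    computes_within P (encode_tournament T) (c * n ^ k + c) (encode_perm n (rank_alg T))"
  proof (intro exI allI impI)
    fix n T assume "tournament n T"
    then have T: "T \<in> carrier_mat n n" by (simp add: tournament_def)
    then interpret rank_run T n by unfold_locales
    define M where "M = (\<lambda>a. if 0 \<le> a \<and> a < int (length (encode_tournament T))
      then encode_tournament T ! nat a else 0)"
    have len: "length (encode_tournament T) = Suc (n * n)"
      using T by (simp add: encode_tournament_def length_concat o_def sum_list_triv)
    have "M (1 + int (i * n + j)) = T $$ (i, j)" if "i < n" "j < n" for i j
    proof -
      have "i * n + j < Suc i * n" using that by simp
      also have "\<dots> \<le> n * n" using that by (intro mult_le_mono1) simp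
      finally have "i * n + j < n * n" .
      moreover have "nat (1 + int (i * n + j)) = Suc (i * n + j)" by linarith
      ultimately have "M (1 + int (i * n + j)) = encode_tournament T ! Suc (i * n + j)"
        unfolding M_def len by (simp del: of_nat_mult of_nat_add)
      then show ?thesis using that T by (simp add: encode_tournament_def concat_rows_nth)
    qed
    then have ok: "input_ok M" by (simp add: input_ok_def)
    have M0: "M 0 = int n" using T by (simp add: M_def encode_tournament_def)
    show "computes_within rank_prog (encode_tournament T) (42 * n ^ 2 + 42)
        (encode_perm n (rank_alg T))"
    proof (rule computes_withinI)
      \<comment> \<open>The linear term is absorbed into the square, whence 42 = 17 + 25.\<close>
      have "n \<le> n\<^sup>2" by (simp add: power2_eq_square)
      then have "17 * n\<^sup>2 + 25 * n + 11 \<le> 42 * n ^ 2 + 42" by linarith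
      with rank_prog_reaches[OF M0 ok]
      show "reaches rank_prog (42 * n ^ 2 + 42) (initial_config (encode_tournament T))
          (\<lambda>(pc, R, M). length rank_prog \<le> pc \<and>
            (\<forall>i<length (encode_perm n (rank_alg T)). M (int i) = encode_perm n (rank_alg T) ! i))"
        unfolding initial_config_def M_def[symmetric]
        by (rule reaches_mono) (auto simp: encode_perm_def)
    qed
  qed
qed

section \<open>Uniform bounds for the noise\<close>

definition noise :: "real \<Rightarrow> ('e \<Rightarrow> bool) \<Rightarrow> 'e \<Rightarrow> real" where
  "noise \<mu> s e = (if s e then 1 else -1) - \<mu>"

text \<open>A coin with weight \<open>c e\<close> ranges over an interval of length
  \<open>2 * \<bar>c e\<bar>\<close>, which puts four times the sum of squares into the denominator
  of Hoeffding's exponent. An upper bound \<open>V\<close> for that sum lets a whole family of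
  weights share one estimate.\<close>

lemma Hoeffding_signs:
  fixes c :: "'e \<Rightarrow> real"
  assumes fin: "finite E" and p: "p \<in> {0..1}" and V: "(\<Sum>e\<in>E. (c e)\<^sup>2) \<le> V" "0 < V" and t: "0 < t"
  shows "measure_pmf.prob (Pi_pmf E False (\<lambda>_. bernoulli_pmf p))
    {s. t \<le> \<bar>\<Sum>e\<in>E. c e * noise (2 * p - 1) s e\<bar>} \<le> 2 * exp (- (t\<^sup>2 / (2 * V)))"
proof (cases "(\<Sum>e\<in>E. (c e)\<^sup>2) = 0")
  \<comment> \<open>Hoeffding's inequality needs intervals that are not all degenerate. If all
    weights vanish, the event is empty because \<open>t\<close> is positive.\<close>
  case True
  then have "c e = 0" if "e \<in> E" for e
    using that fin by (simp add: sum_nonneg_eq_0_iff)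
  then have "{s. t \<le> \<bar>\<Sum>e\<in>E. c e * noise (2 * p - 1) s e\<bar>} = {}" using t by auto
  then show ?thesis by simp
next
  case False
  then have pos: "0 < (\<Sum>e\<in>E. (c e)\<^sup>2)" by (metis less_eq_real_def sum_nonneg zero_le_power2)
  let ?M = "Pi_pmf E False (\<lambda>_. bernoulli_pmf p)"
  define X where "X = (\<lambda>e (s :: 'e \<Rightarrow> bool). c e * (if s e then 1 else -1))"
  have ex: "measure_pmf.expectation ?M (X e) = c e * (2 * p - 1)" if "e \<in> E" for e
  proof -
    have "measure_pmf.expectation ?M (X e) =
        measure_pmf.expectation (map_pmf (\<lambda>s. s e) ?M) (\<lambda>b. c e * (if b then 1 else -1))"
      by (simp add: X_def)
    also have "map_pmf (\<lambda>s. s e) ?M = bernoulli_pmf p"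
      using that fin by (simp add: Pi_pmf_component)
    finally show ?thesis using p by (simp add: algebra_simps)
  qed
  interpret Hoeffding_ineq ?M E X "\<lambda>e. - \<bar>c e\<bar>" "\<lambda>e. \<bar>c e\<bar>"
    "\<Sum>e\<in>E. measure_pmf.expectation ?M (X e)"
  proof unfold_locales
    show "prob_space.indep_vars (measure_pmf ?M) (\<lambda>_. borel) X E"
      unfolding X_def
      by (intro prob_space.indep_vars_compose2[OF _ indep_vars_Pi_pmf])
         (auto simp: fin measure_pmf.prob_space_axioms)
  qed (auto simp: fin X_def)
  have "(\<Sum>e\<in>E. measure_pmf.expectation ?M (X e)) = (\<Sum>e\<in>E. c e * (2 * p - 1))"
    by (rule sum.cong) (simp_all add: ex)
  then have "(\<Sum>e\<in>E. X e s) - (\<Sum>e\<in>E. measure_pmf.expectation ?M (X e)) =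
      (\<Sum>e\<in>E. c e * noise (2 * p - 1) s e)" for s
    by (simp only: X_def noise_def right_diff_distrib sum_subtractf)
  moreover have four: "(\<Sum>e\<in>E. (\<bar>c e\<bar> - - \<bar>c e\<bar>)\<^sup>2) = 4 * (\<Sum>e\<in>E. (c e)\<^sup>2)"
    by (simp add: sum_distrib_left power_mult_distrib flip: mult_2)
  ultimately have "measure_pmf.prob ?M {s. t \<le> \<bar>\<Sum>e\<in>E. c e * noise (2 * p - 1) s e\<bar>}
      \<le> 2 * exp (- 2 * t\<^sup>2 / (4 * (\<Sum>e\<in>E. (c e)\<^sup>2)))"
    using Hoeffding_ineq_abs_ge[of t] t pos by simp
  also have "\<dots> \<le> 2 * exp (- (t\<^sup>2 / (2 * V)))"
    using pos V by (simp add: frac_le)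
  finally show ?thesis .
qed

lemma Hoeffding_signs_family:
  fixes c :: "'i \<Rightarrow> 'e \<Rightarrow> real"
  assumes "finite E" "p \<in> {0..1}" "finite I"
    and "\<And>i. i \<in> I \<Longrightarrow> (\<Sum>e\<in>E. (c i e)\<^sup>2) \<le> V" "0 < V" "0 < t"
  shows "measure_pmf.prob (Pi_pmf E False (\<lambda>_. bernoulli_pmf p))
    {s. \<exists>i\<in>I. t \<le> \<bar>\<Sum>e\<in>E. c i e * noise (2 * p - 1) s e\<bar>}
    \<le> card I * (2 * exp (- (t\<^sup>2 / (2 * V))))"
proof -
  let ?M = "measure_pmf (Pi_pmf E False (\<lambda>_. bernoulli_pmf p))"
  let ?A = "\<lambda>i. {s. t \<le> \<bar>\<Sum>e\<in>E. c i e * noise (2 * p - 1) s e\<bar>}"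
  have "{s. \<exists>i\<in>I. t \<le> \<bar>\<Sum>e\<in>E. c i e * noise (2 * p - 1) s e\<bar>} = (\<Union>i\<in>I. ?A i)" by blast
  also have "measure ?M \<dots> \<le> (\<Sum>i\<in>I. measure ?M (?A i))"
    by (rule measure_UNION_le[OF assms(3)]) simp
  also have "\<dots> \<le> (\<Sum>i\<in>I. 2 * exp (- (t\<^sup>2 / (2 * V))))"
    by (intro sum_mono Hoeffding_signs[OF assms(1,2) assms(4) assms(5,6)])
  also have "\<dots> = card I * (2 * exp (- (t\<^sup>2 / (2 * V))))" by (rule sum_constant)
  finally show ?thesis .
qed


text \<open>The weights are at most 1 in absolute value and there are at most n^2 pairs, so the
  threshold gives the exponent 4 n^3 / (2 n^2) = 2 n. This beats the 2^n <= e^n vertex sets and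
  leaves e^(-n).\<close>

lemma noise_vertex_sets:
  fixes p :: real
  assumes E: "E \<subseteq> {..<n} \<times> {..<n}" and p: "p \<in> {0..1}" and n: "0 < n"
  shows "measure_pmf.prob (Pi_pmf E False (\<lambda>_. bernoulli_pmf p))
    {s. \<exists>B\<in>Pow {..<n}. 2 * real n powr (3/2) \<le>
      \<bar>\<Sum>e\<in>E. (of_bool (fst e \<in> B) - of_bool (snd e \<in> B)) * noise (2 * p - 1) s e\<bar>} \<le> 2 * exp (- real n)"
proof -
  let ?t = "2 * real n powr (3/2)"
  have fin: "finite E" by (rule finite_subset[OF E]) simp
  have "card E \<le> card ({..<n} \<times> {..<n})" using E by (intro card_mono) auto
  then have cE: "real (card E) \<le> (real n)\<^sup>2"
    by (simp add: power2_eq_square flip: of_nat_mult)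
  have "(\<Sum>e\<in>E. (of_bool (fst e \<in> B) - of_bool (snd e \<in> B) :: real)\<^sup>2) \<le> (\<Sum>e\<in>E. 1)" for B
    by (intro sum_mono) auto
  also have "(\<Sum>e\<in>E. 1) \<le> (real n)\<^sup>2" using cE by simp
  finally have V: "(\<Sum>e\<in>E. (of_bool (fst e \<in> B) - of_bool (snd e \<in> B) :: real)\<^sup>2) \<le> (real n)\<^sup>2" for B .
  have "measure_pmf.prob (Pi_pmf E False (\<lambda>_. bernoulli_pmf p))
    {s. \<exists>B\<in>Pow {..<n}. ?t \<le>
      \<bar>\<Sum>e\<in>E. (of_bool (fst e \<in> B) - of_bool (snd e \<in> B)) * noise (2 * p - 1) s e\<bar>}
    \<le> card (Pow {..<n}) * (2 * exp (- (?t\<^sup>2 / (2 * (real n)\<^sup>2))))"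
  proof (rule Hoeffding_signs_family[OF fin p])
    show "(\<Sum>e\<in>E. (of_bool (fst e \<in> B) - of_bool (snd e \<in> B) :: real)\<^sup>2) \<le> (real n)\<^sup>2" for B
      by (rule V)
  qed (use n in simp_all)
  also have "?t\<^sup>2 = 4 * real n ^ 3"
    using n by (simp add: power_mult_distrib powr_power)
  also have "4 * real n ^ 3 / (2 * (real n)\<^sup>2) = 2 * real n"
    using n by (simp add: power2_eq_square power3_eq_cube)
  also have "card (Pow {..<n}) * (2 * exp (- (2 * real n))) = 2 * (2 ^ n * exp (- (2 * real n)))"
    by (simp add: card_Pow)
  also have "\<dots> \<le> 2 * (exp (real n) * exp (- (2 * real n)))"
  proof (intro mult_left_mono mult_right_mono)
    have "(2::real) ^ n \<le> exp 1 ^ n"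
      using exp_ge_add_one_self[of 1] by (intro power_mono) simp_all
    also have "\<dots> = exp (real n)" using exp_of_nat_mult[of n "1::real"] by simp
    finally show "(2::real) ^ n \<le> exp (real n)" .
  qed simp_all
  also have "exp (real n) * exp (- (2 * real n)) = exp (- real n)"
    by (simp flip: exp_add)
  finally show ?thesis .
qed

section \<open>Chaining over binary scales\<close>

text \<open>The order relation between \<open>\<rho> i\<close> and \<open>\<rho> j\<close> is decided at the unique binary scale at which the two
  numbers separate; \<open>scale_sgn\<close> is the contribution of scale \<open>m\<close>, as a function of the numbers
  \<open>q i = \<rho> i div 2 ^ m\<close>.\<close>

definition scale_sgn :: "(nat \<Rightarrow> nat) \<Rightarrow> nat \<times> nat \<Rightarrow> real" where
  "scale_sgn q = (\<lambda>(i, j). sgn (real (q j) - real (q i)) - sgn (real (q j div 2) - real (q i div 2)))"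

text \<open>Halving is monotone: two numbers still separated after halving were in the same order
  before, and the two signs cancel. Only pairs that share a block at the next coarser scale
  contribute.\<close>

lemma scale_sgn_sq_le: "(scale_sgn q (i, j))\<^sup>2 \<le> of_bool (q i div 2 = q j div 2)"
proof -
  have pos: "sgn (real b - real a) = 1" and neg: "sgn (real a - real b) = - 1" if "a < b" for a b
    using that by simp_all
  have mono: "a < b" if "a div 2 < b div 2" for a b :: nat
    by (rule ccontr) (use that div_le_mono[of b a 2] in linarith)
  consider "q i div 2 = q j div 2" | "q i div 2 < q j div 2" | "q j div 2 < q i div 2"
    by (rule linorder_cases)
  then show ?thesis
  proof cases
    case 1
    have "(sgn x)\<^sup>2 \<le> 1" for x :: real
      by (cases x "0 :: real" rule: linorder_cases) simp_all
    then show ?thesis unfolding scale_sgn_def prod.case 1 by simp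
  next
    case 2
    show ?thesis unfolding scale_sgn_def prod.case pos[OF 2] pos[OF mono[OF 2]] by simp
  next
    case 3
    show ?thesis unfolding scale_sgn_def prod.case neg[OF 3] neg[OF mono[OF 3]] by simp
  qed
qed

text \<open>The sum over scales telescopes, and at scale \<open>L\<close> both numbers have become
  0.\<close>

lemma sgn_eq_sum_scale_sgn:
  assumes "\<rho> i < 2 ^ L" "\<rho> j < 2 ^ L"
  shows "sgn (real (\<rho> j) - real (\<rho> i)) = (\<Sum>m<L. scale_sgn (\<lambda>i. \<rho> i div 2 ^ m) (i, j))"
proof -
  define f where "f = (\<lambda>m. sgn (real (\<rho> j div 2 ^ m) - real (\<rho> i div 2 ^ m)))"
  have "scale_sgn (\<lambda>i. \<rho> i div 2 ^ m) (i, j) = f m - f (Suc m)" for m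
    by (simp add: scale_sgn_def f_def div_mult2_eq power_Suc2 del: power_Suc)
  then have "(\<Sum>m<L. scale_sgn (\<lambda>i. \<rho> i div 2 ^ m) (i, j)) = f 0 - f L"
    by (simp add: sum_lessThan_telescope')
  also have "f L = 0" using assms by (simp add: f_def)
  finally show ?thesis by (simp add: f_def)
qed

lemma card_div_eq_le:
  fixes \<rho> :: "nat \<Rightarrow> nat"
  assumes "inj_on \<rho> A" "0 < K" "finite A"
  shows "card {j\<in>A. \<rho> j div K = r} \<le> K"
proof -
  have "\<rho> ` {j\<in>A. \<rho> j div K = r} \<subseteq> {r * K..<r * K + K}"
    using assms(2) by (auto simp: dividend_less_times_div mult.commute add.commute)
  then have "card (\<rho> ` {j\<in>A. \<rho> j div K = r}) \<le> card {r * K..<r * K + K}"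
    by (intro card_mono) auto
  moreover have "inj_on \<rho> {j\<in>A. \<rho> j div K = r}"
    using assms(1) by (rule inj_on_subset) auto
  ultimately show ?thesis by (simp add: card_image)
qed

text \<open>By injectivity of \<open>\<rho>\<close>, a block of length \<open>2 ^ Suc m\<close>
  contains at most that many vertices, so each vertex takes part in at most that many contributing
  pairs.\<close>

lemma sum_scale_sgn_sq_le:
  assumes E: "E \<subseteq> {..<n} \<times> {..<n}" and \<rho>: "\<rho> permutes {..<n}"
  shows "(\<Sum>e\<in>E. (scale_sgn (\<lambda>i. \<rho> i div 2 ^ m) e)\<^sup>2) \<le> real n * 2 ^ Suc m"
proof -
  let ?q = "\<lambda>i. \<rho> i div 2 ^ m"
  have "(\<Sum>e\<in>E. (scale_sgn ?q e)\<^sup>2) \<le> (\<Sum>e\<in>{..<n} \<times> {..<n}. (scale_sgn ?q e)\<^sup>2)"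
    using E by (intro sum_mono2) auto
  also have "\<dots> = (\<Sum>i<n. \<Sum>j<n. (scale_sgn ?q (i, j))\<^sup>2)"
    by (simp add: sum.cartesian_product)
  also have "\<dots> \<le> (\<Sum>i<n. \<Sum>j<n. of_bool (?q i div 2 = ?q j div 2))"
    by (intro sum_mono scale_sgn_sq_le)
  also have "\<dots> \<le> (\<Sum>i<n. 2 ^ Suc m)"
  proof (intro sum_mono)
    fix i
    let ?B = "{j\<in>{..<n}. \<rho> j div 2 ^ Suc m = \<rho> i div 2 ^ Suc m}"
    have "?B = {..<n} \<inter> {j. \<rho> i div 2 ^ Suc m = \<rho> j div 2 ^ Suc m}" by (auto simp del: power_Suc)
    moreover have "?q a div 2 = \<rho> a div 2 ^ Suc m" for a
      by (simp only: power_Suc2 div_mult2_eq)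
    ultimately have "(\<Sum>j<n. of_bool (?q i div 2 = ?q j div 2) :: real) = card ?B"
      by (simp only: sum_of_bool_eq finite_lessThan)
    also have "\<dots> \<le> real (2 ^ Suc m)"
      unfolding of_nat_le_iff by (rule card_div_eq_le[OF permutes_inj_on[OF \<rho>]]) simp_all
    finally show "(\<Sum>j<n. of_bool (?q i div 2 = ?q j div 2) :: real) \<le> 2 ^ Suc m" by simp
  qed
  finally show ?thesis by simp
qed

text \<open>At the scale with n / 2^m = x, the union bound costs n ln (x + 1) in the exponent while
  Hoeffding's inequality gains 4 n sqrt x; this inequality leaves a surplus of n. It comes from ln z
  <= z - 1 at z = sqrt (x + 1).\<close>

lemma ln_le_sqrt:
  fixes x :: real
  assumes "1 \<le> x"
  shows "ln (x + 1) + 1 \<le> 4 * sqrt x"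
proof -
  have "ln (x + 1) = 2 * ln (sqrt (x + 1))" using assms by (simp add: ln_sqrt)
  also have "\<dots> \<le> 2 * (sqrt (x + 1) - 1)"
    using assms by (intro mult_left_mono ln_le_minus_one) auto
  also have "sqrt (x + 1) \<le> sqrt (4 * x)" using assms by simp
  finally show ?thesis by (simp add: real_sqrt_mult)
qed

text \<open>With x = n / 2^m, there are at most (x + 1)^n configurations and the sum of squares is
  at most V = 2 n 2^m. The threshold t is chosen so that t^2 / (2 V) = 4 n sqrt x, just enough to
  pay for the union bound, while it still grows geometrically in m.\<close>

lemma noise_scale:
  fixes p :: real
  assumes E: "E \<subseteq> {..<n} \<times> {..<n}" and p: "p \<in> {0..1}" and n: "0 < n" and m: "2 ^ m \<le> n"
  shows "measure_pmf.prob (Pi_pmf E False (\<lambda>_. bernoulli_pmf p))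
    {s. \<exists>\<rho>. \<rho> permutes {..<n} \<and> 4 * real n powr (5/4) * (2 powr (1/4)) ^ m \<le>
      \<bar>\<Sum>e\<in>E. scale_sgn (\<lambda>i. \<rho> i div 2 ^ m) e * noise (2 * p - 1) s e\<bar>} \<le> 2 * exp (- real n)"
    (is "measure_pmf.prob ?M ?A \<le> _")
proof -
  define t where "t = 4 * real n powr (5/4) * (2 powr (1/4)) ^ m"
  define V where "V = real n * 2 ^ Suc m"
  \<comment> \<open>The sum depends on \<open>\<rho>\<close> only through the block numbers of the
    vertices. Restricting to the vertex set places these functions in a finite product, whose size
    bounds their number.\<close>
  define I where "I = (\<lambda>\<rho>. restrict (\<lambda>i. \<rho> i div 2 ^ m) {..<n}) ` {\<rho>. \<rho> permutes {..<n}}"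
  have fin: "finite E" by (rule finite_subset[OF E]) simp
  have finI: "finite I" unfolding I_def by (intro finite_imageI finite_permutations) simp
  have restr: "scale_sgn (restrict q {..<n}) e = scale_sgn q e" if "e \<in> E" for q e
    using that E by (auto simp: scale_sgn_def)
  have "I \<subseteq> PiE {..<n} (\<lambda>_. {..n div 2 ^ m})"
    unfolding I_def
  proof (rule image_subsetI)
    fix \<rho> assume "\<rho> \<in> {\<rho>. \<rho> permutes {..<n}}"
    then have "\<rho> i < n" if "i < n" for i using that permutes_in_image[of \<rho> "{..<n}" i] by simp
    then have "\<rho> i div 2 ^ m \<le> n div 2 ^ m" if "i < n" for i
      using that by (intro div_le_mono less_imp_le)
    then show "restrict (\<lambda>i. \<rho> i div 2 ^ m) {..<n} \<in> PiE {..<n} (\<lambda>_. {..n div 2 ^ m})"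
      by (simp add: restrict_PiE_iff)
  qed
  then have "card I \<le> card (PiE {..<n} (\<lambda>_. {..n div 2 ^ m}))"
    by (intro card_mono finite_PiE) auto
  also have "\<dots> = Suc (n div 2 ^ m) ^ n" by (simp add: card_PiE)
  finally have "real (card I) \<le> real (Suc (n div 2 ^ m) ^ n)" by (rule of_nat_mono)
  also have "\<dots> = (real (n div 2 ^ m) + 1) ^ n" by (simp add: add.commute)
  finally have cI: "real (card I) \<le> (real (n div 2 ^ m) + 1) ^ n" .
  define x where "x = real n / 2 ^ m"
  have x: "1 \<le> x" using m unfolding x_def by (simp add: numeral_power_le_of_nat_cancel_iff)
  have dx: "real (n div 2 ^ m) \<le> x"
    unfolding x_def using of_nat_div_le_of_nat[of n "2 ^ m", where ?'a = real] by simp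
  have tV: "t\<^sup>2 / (2 * V) = real n * (4 * sqrt x)"
  proof -
    have "(real n powr (5/4))\<^sup>2 = real n powr (2 + 1 / 2)"
      unfolding power2_eq_square powr_add[symmetric] by simp
    then have a: "(real n powr (5/4))\<^sup>2 = (real n)\<^sup>2 * sqrt (real n)"
      using n by (simp only: powr_add) (simp add: powr_half_sqrt)
    have "(2 powr (1/4))\<^sup>2 = sqrt (2 :: real)"
      unfolding power2_eq_square powr_add[symmetric] by (simp add: powr_half_sqrt)
    then have b: "((2 powr (1/4)) ^ m)\<^sup>2 = sqrt 2 ^ m"
      by (simp only: power_mult[symmetric] mult.commute[of m]) (simp only: power_mult)
    have c: "(2::real) ^ m = sqrt 2 ^ m * sqrt 2 ^ m" by (simp flip: power_mult_distrib)
    have "t\<^sup>2 / (2 * V) = 16 * ((real n)\<^sup>2 * sqrt (real n)) * sqrt 2 ^ m / (4 * real n * 2 ^ m)"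
      unfolding t_def V_def power_mult_distrib a b by simp
    also have "\<dots> = real n * (4 * (sqrt (real n) / sqrt 2 ^ m))"
      unfolding c using n by (simp add: field_simps power2_eq_square)
    finally show ?thesis by (simp add: x_def real_sqrt_divide real_sqrt_power)
  qed
  have "(\<Sum>e\<in>E. scale_sgn (restrict q {..<n}) e * noise (2 * p - 1) s e) =
      (\<Sum>e\<in>E. scale_sgn q e * noise (2 * p - 1) s e)" for q s
    by (intro sum.cong refl) (simp only: restr)
  then have "?A = {s. \<exists>q\<in>I. t \<le> \<bar>\<Sum>e\<in>E. scale_sgn q e * noise (2 * p - 1) s e\<bar>}"
    unfolding I_def t_def[symmetric] by simp
  also have "measure_pmf.prob ?M \<dots> \<le> card I * (2 * exp (- (t\<^sup>2 / (2 * V))))"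
  proof (rule Hoeffding_signs_family)
    show "(\<Sum>e\<in>E. (scale_sgn q e)\<^sup>2) \<le> V" if q: "q \<in> I" for q
    proof -
      obtain \<rho> where \<rho>: "\<rho> permutes {..<n}" "q = restrict (\<lambda>i. \<rho> i div 2 ^ m) {..<n}"
        using q unfolding I_def by blast
      have "(\<Sum>e\<in>E. (scale_sgn q e)\<^sup>2) = (\<Sum>e\<in>E. (scale_sgn (\<lambda>i. \<rho> i div 2 ^ m) e)\<^sup>2)"
        unfolding \<rho>(2) by (intro sum.cong refl) (simp only: restr)
      then show ?thesis using sum_scale_sgn_sq_le[OF E \<rho>(1), of m] by (simp only: V_def)
    qed
  qed (use fin p n finI in \<open>simp_all add: V_def t_def\<close>)
  also have "\<dots> \<le> (x + 1) ^ n * (2 * exp (- (t\<^sup>2 / (2 * V))))"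
  proof -
    have "real (card I) \<le> (x + 1) ^ n" by (rule order_trans[OF cI], rule power_mono) (use dx in auto)
    then show ?thesis by (intro mult_right_mono) auto
  qed
  also have "(x + 1) ^ n = exp (real n * ln (x + 1))"
    using x by (simp add: exp_of_nat_mult)
  also have "exp (real n * ln (x + 1)) * (2 * exp (- (t\<^sup>2 / (2 * V)))) =
      2 * exp (real n * (ln (x + 1) - 4 * sqrt x))"
    unfolding tV right_diff_distrib exp_diff by (simp only: exp_minus divide_inverse mult_ac)
  also have "\<dots> \<le> 2 * exp (- real n)"
  proof -
    have "real n * (ln (x + 1) - 4 * sqrt x) \<le> real n * (- 1)"
      using ln_le_sqrt[OF x] by (intro mult_left_mono) simp_all
    then show ?thesis by simp
  qed
  finally show ?thesis .
qed

text \<open>The ratio r = 2^(1/4) exceeds 11/10, so r / (r - 1) is at most 11; the largest term of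
  the geometric series governs the sum.\<close>

lemma sum_power_root_two_le:
  fixes x :: real
  assumes "2 ^ L \<le> 2 * x"
  shows "(\<Sum>m<L. (2 powr (1/4)) ^ m) \<le> 11 * x powr (1/4)"
proof -
  define r :: real where "r = 2 powr (1/4)"
  have "r ^ 4 = 2" by (simp add: r_def powr_power)
  moreover have "(11 / 10 :: real) ^ 4 < 2" by (simp add: power_divide)
  ultimately have r: "11 / 10 < r"
    using power_less_imp_less_base[of "11 / 10" 4 r] by (simp add: r_def)
  have "r ^ L = (2 ^ L) powr (1/4)"
    by (simp add: r_def powr_power powr_powr flip: powr_realpow)
  also have "\<dots> \<le> (2 * x) powr (1/4)" using assms by (intro powr_mono2) simp_all
  also have "\<dots> = r * x powr (1/4)"
  proof -
    have "0 < 2 * x" using assms by (rule less_le_trans[rotated]) simp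
    then show ?thesis by (simp add: r_def powr_mult)
  qed
  finally have rL: "r ^ L \<le> r * x powr (1/4)" .
  have "(\<Sum>m<L. r ^ m) = (r ^ L - 1) / (r - 1)"
    using r by (intro geometric_sum) simp
  also have "\<dots> \<le> r * x powr (1/4) / (r - 1)"
    using r rL by (intro divide_right_mono) simp_all
  also have "\<dots> = (r / (r - 1)) * x powr (1/4)" by simp
  also have "\<dots> \<le> 11 * x powr (1/4)"
    using r by (intro mult_right_mono) (simp_all add: field_simps)
  finally show ?thesis by (simp only: r_def)
qed

text \<open>The thresholds of all scales add up to at most 4 * 11 = 44 times n^(5/4) n^(1/4) =
  n^(3/2). If the total noise exceeds this, then some scale exceeds its own threshold, and a union
  bound over at most \<open>n\<close> scales suffices.\<close>

lemma noise_orderings: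
  fixes p :: real
  assumes E: "E \<subseteq> {..<n} \<times> {..<n}" and p: "p \<in> {0..1}" and n: "0 < n"
  shows "measure_pmf.prob (Pi_pmf E False (\<lambda>_. bernoulli_pmf p))
    {s. \<exists>\<rho>. \<rho> permutes {..<n} \<and> 44 * real n powr (3/2) <
      \<bar>\<Sum>e\<in>E. sgn (real (\<rho> (snd e)) - real (\<rho> (fst e))) * noise (2 * p - 1) s e\<bar>}
    \<le> real n * (2 * exp (- real n))"
    (is "measure_pmf.prob ?M ?A \<le> _")
proof -
  \<comment> \<open>Minimality makes \<open>2 ^ m\<close> at most \<open>n\<close> at every scale
    used and \<open>2 ^ L\<close> at most \<open>2 * n\<close>, while \<open>n \<le> 2 ^ L\<close>
    makes the top scale trivial.\<close>
  define L where "L = (LEAST L. n \<le> 2 ^ L)"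
  have nL: "n \<le> 2 ^ L" unfolding L_def by (rule LeastI[of _ n]) (simp add: less_imp_le)
  have Ln: "L \<le> n" unfolding L_def by (rule Least_le) (simp add: less_imp_le)
  have small: "2 ^ m \<le> n" if "m < L" for m
    using not_less_Least[OF that[unfolded L_def]] by simp
  have "(2 :: nat) ^ L \<le> 2 * n"
  proof (cases L)
    case 0
    then show ?thesis using n by simp
  next
    case (Suc l)
    then show ?thesis using small[of l] by simp
  qed
  then have L2: "(2 :: real) ^ L \<le> 2 * real n"
    by (metis of_nat_le_iff of_nat_mult of_nat_numeral of_nat_power)
  define t where "t = (\<lambda>m. 4 * real n powr (5/4) * (2 powr (1/4)) ^ m)"
  define Z where "Z = (\<lambda>\<rho> m s. \<Sum>e\<in>E. scale_sgn (\<lambda>i. \<rho> i div 2 ^ m) e * noise (2 * p - 1) s e)"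
  define B where "B = (\<lambda>m. {s. \<exists>\<rho>. \<rho> permutes {..<n} \<and> t m \<le> \<bar>Z \<rho> m s\<bar>})"
  have "(\<Sum>m<L. t m) = 4 * real n powr (5/4) * (\<Sum>m<L. (2 powr (1/4)) ^ m)"
    by (simp only: t_def sum_distrib_left)
  also have "\<dots> \<le> 4 * real n powr (5/4) * (11 * real n powr (1/4))"
    by (intro mult_left_mono sum_power_root_two_le L2) simp
  also have "\<dots> = 44 * (real n powr (5/4) * real n powr (1/4))" by simp
  also have "real n powr (5/4) * real n powr (1/4) = real n powr (3/2)"
    by (simp flip: powr_add)
  finally have sum_t: "(\<Sum>m<L. t m) \<le> 44 * real n powr (3/2)" .
  have "?A \<subseteq> (\<Union>m<L. B m)"
  proof
    fix s assume "s \<in> ?A"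
    then obtain \<rho> where \<rho>: "\<rho> permutes {..<n}" and big: "44 * real n powr (3/2) <
      \<bar>\<Sum>e\<in>E. sgn (real (\<rho> (snd e)) - real (\<rho> (fst e))) * noise (2 * p - 1) s e\<bar>" by blast
    have lt: "\<rho> i < 2 ^ L" if "i < n" for i
      using permutes_in_image[OF \<rho>, of i] that nL by simp
    have "(\<Sum>e\<in>E. sgn (real (\<rho> (snd e)) - real (\<rho> (fst e))) * noise (2 * p - 1) s e) =
        (\<Sum>e\<in>E. \<Sum>m<L. scale_sgn (\<lambda>i. \<rho> i div 2 ^ m) e * noise (2 * p - 1) s e)"
    proof (rule sum.cong[OF refl])
      fix e assume "e \<in> E"
      then have "\<rho> (fst e) < 2 ^ L" "\<rho> (snd e) < 2 ^ L" using E lt by auto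
      from sgn_eq_sum_scale_sgn[of \<rho>, OF this]
      show "sgn (real (\<rho> (snd e)) - real (\<rho> (fst e))) * noise (2 * p - 1) s e =
          (\<Sum>m<L. scale_sgn (\<lambda>i. \<rho> i div 2 ^ m) e * noise (2 * p - 1) s e)"
        by (simp only: sum_distrib_right prod.collapse)
    qed
    also have "\<dots> = (\<Sum>m<L. Z \<rho> m s)" unfolding Z_def by (rule sum.swap)
    finally have "44 * real n powr (3/2) < \<bar>\<Sum>m<L. Z \<rho> m s\<bar>" using big by simp
    also have "\<dots> \<le> (\<Sum>m<L. \<bar>Z \<rho> m s\<bar>)" by (rule sum_abs)
    finally have "(\<Sum>m<L. t m) < (\<Sum>m<L. \<bar>Z \<rho> m s\<bar>)" using sum_t by simp
    then have "\<exists>m<L. t m < \<bar>Z \<rho> m s\<bar>"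
      using sum_mono[of "{..<L}" "\<lambda>m. \<bar>Z \<rho> m s\<bar>" t] by force
    then show "s \<in> (\<Union>m<L. B m)" unfolding B_def using \<rho> by force
  qed
  then have "measure_pmf.prob ?M ?A \<le> measure_pmf.prob ?M (\<Union>m<L. B m)"
    by (intro measure_pmf.finite_measure_mono) simp_all
  also have "\<dots> \<le> (\<Sum>m<L. measure_pmf.prob ?M (B m))"
    by (rule measure_UNION_le) simp_all
  also have "\<dots> \<le> (\<Sum>m<L. 2 * exp (- real n))"
    unfolding B_def t_def Z_def using noise_scale[OF E p n small] by (intro sum_mono) simp
  also have "\<dots> \<le> real n * (2 * exp (- real n))"
    using Ln by simp
  finally show ?thesis .
qed

section \<open>The planted tournament as a linear function of the coins\<close>

definition ordered_pairs :: "nat \<Rightarrow> (nat \<Rightarrow> nat) \<Rightarrow> (nat \<times> nat) set" where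
  "ordered_pairs n \<pi> = {(i, j). i < n \<and> j < n \<and> \<pi> i < \<pi> j}"

definition planted_matrix :: "nat \<Rightarrow> (nat \<Rightarrow> nat) \<Rightarrow> (nat \<times> nat \<Rightarrow> bool) \<Rightarrow> int mat" where
  "planted_matrix n \<pi> s = mat n n (\<lambda>(i, j).
     if \<pi> i < \<pi> j then (if s (i, j) then 1 else -1)
     else if \<pi> j < \<pi> i then (if s (j, i) then -1 else 1)
     else 0)"

lemma planted_model_eq:
  "planted_model n \<gamma> = bind_pmf (pmf_of_set {\<pi>. \<pi> permutes {..<n}})
     (\<lambda>\<pi>. map_pmf (planted_matrix n \<pi>)
       (Pi_pmf (ordered_pairs n \<pi>) False (\<lambda>_. bernoulli_pmf (1/2 + \<gamma>))))"
  unfolding planted_model_def ordered_pairs_def planted_matrix_def map_pmf_def ..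

lemma ordered_pairs_subset: "ordered_pairs n \<pi> \<subseteq> {..<n} \<times> {..<n}"
  by (auto simp: ordered_pairs_def)

lemma finite_ordered_pairs: "finite (ordered_pairs n \<pi>)"
  by (rule finite_subset[OF ordered_pairs_subset]) simp

lemma sum_ordered_pairs:
  fixes h :: "nat \<times> nat \<Rightarrow> real"
  shows "(\<Sum>e\<in>ordered_pairs n \<pi>. h e) = (\<Sum>a<n. \<Sum>b<n. if \<pi> a < \<pi> b then h (a, b) else 0)"
proof -
  have "(\<Sum>e\<in>ordered_pairs n \<pi>. h e) =
      (\<Sum>e\<in>{..<n} \<times> {..<n}. if \<pi> (fst e) < \<pi> (snd e) then h e else 0)"
    by (rule sum.mono_neutral_cong_left) (auto simp: ordered_pairs_def)
  also have "\<dots> = (\<Sum>a<n. \<Sum>b<n. if \<pi> a < \<pi> b then h (a, b) else 0)"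
    unfolding sum.cartesian_product by (intro sum.cong refl) (simp add: case_prod_beta)
  finally show ?thesis .
qed

lemma card_ordered_pairs:
  assumes "\<pi> permutes {..<n}"
  shows "2 * real (card (ordered_pairs n \<pi>)) = (real n)\<^sup>2 - real n"
proof -
  have "real (card (ordered_pairs n \<pi>)) = (\<Sum>a<n. \<Sum>b<n. if \<pi> a < \<pi> b then 1 else 0)"
    using sum_ordered_pairs[of "\<lambda>_. 1" n \<pi>] by simp
  moreover have "\<dots> = (\<Sum>a<n. \<Sum>b<n. if \<pi> b < \<pi> a then 1 else 0)"
    by (rule sum.swap)
  ultimately have "2 * real (card (ordered_pairs n \<pi>)) =
      (\<Sum>a<n. \<Sum>b<n. (if \<pi> a < \<pi> b then 1 else 0) + (if \<pi> b < \<pi> a then 1 else 0))"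
    by (simp only: sum.distrib)
  also have "\<dots> = (\<Sum>a<n. \<Sum>b<n. 1 - (if b = a then 1 else 0))"
  proof (intro sum.cong refl)
    fix a b
    have "\<pi> a = \<pi> b \<longleftrightarrow> a = b" using permutes_inj[OF assms] by (auto dest: injD)
    then show "(if \<pi> a < \<pi> b then 1 else 0) + (if \<pi> b < \<pi> a then 1 else (0::real)) =
        1 - (if b = a then 1 else 0)" by (cases "\<pi> a" "\<pi> b" rule: linorder_cases) auto
  qed
  also have "\<dots> = (real n)\<^sup>2 - real n"
    by (simp add: sum_subtractf power2_eq_square right_diff_distrib)
  finally show ?thesis .
qed

definition coin_sign :: "('e \<Rightarrow> bool) \<Rightarrow> 'e \<Rightarrow> real" where
  "coin_sign s e = (if s e then 1 else -1)"

lemma noise_eq: "noise \<mu> s e = coin_sign s e - \<mu>"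
  by (simp add: noise_def coin_sign_def)

text \<open>Each edge contributes once, in its actual direction. An edge against
  \<open>\<pi>\<close> is counted at the reversed pair, where the sign of the ordering is opposite,
  so reversing a coin negates its contribution.\<close>

lemma align_planted_matrix:
  "real_of_int (align \<rho> (planted_matrix n \<pi> s)) = (\<Sum>e\<in>ordered_pairs n \<pi>.
     sgn (real (\<rho> (snd e)) - real (\<rho> (fst e))) * coin_sign s e)"
proof -
  let ?T = "planted_matrix n \<pi> s"
  define \<sigma> where "\<sigma> = (\<lambda>i j. of_bool (\<rho> i < \<rho> j) - of_bool (\<rho> i > \<rho> j) :: real)"
  have \<sigma>: "sgn (real (\<rho> j) - real (\<rho> i)) = \<sigma> i j" for i j
    by (cases "\<rho> i" "\<rho> j" rule: linorder_cases) (simp_all add: \<sigma>_def)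
  have flip: "\<sigma> j i = - \<sigma> i j" for i j by (simp add: \<sigma>_def)
  have "real_of_int (align \<rho> ?T) = (\<Sum>e\<in>{(i, j). i < n \<and> j < n \<and> ?T $$ (i, j) = 1}. \<sigma> (fst e) (snd e))"
    unfolding align_def \<sigma>_def by (simp add: planted_matrix_def case_prod_beta)
  also have "\<dots> = (\<Sum>e\<in>{..<n} \<times> {..<n}. if ?T $$ e = 1 then \<sigma> (fst e) (snd e) else 0)"
    by (rule sum.mono_neutral_cong_left) auto
  also have "\<dots> = (\<Sum>i<n. \<Sum>j<n. if ?T $$ (i, j) = 1 then \<sigma> i j else 0)"
    unfolding sum.cartesian_product by (intro sum.cong refl) (simp add: case_prod_beta)
  also have "\<dots> = (\<Sum>i<n. \<Sum>j<n. (if \<pi> i < \<pi> j \<and> s (i, j) then \<sigma> i j else 0) +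
      (if \<pi> j < \<pi> i \<and> \<not> s (j, i) then \<sigma> i j else 0))"
    by (intro sum.cong refl) (simp add: planted_matrix_def)
  also have "\<dots> = (\<Sum>i<n. \<Sum>j<n. if \<pi> i < \<pi> j \<and> s (i, j) then \<sigma> i j else 0) +
      (\<Sum>i<n. \<Sum>j<n. if \<pi> j < \<pi> i \<and> \<not> s (j, i) then \<sigma> i j else 0)"
    by (simp only: sum.distrib)
  \<comment> \<open>Renaming the indices makes both sums run over pairs ordered along
    \<open>\<pi>\<close>.\<close>
  also have "(\<Sum>i<n. \<Sum>j<n. if \<pi> j < \<pi> i \<and> \<not> s (j, i) then \<sigma> i j else 0) =
      (\<Sum>i<n. \<Sum>j<n. if \<pi> i < \<pi> j \<and> \<not> s (i, j) then \<sigma> j i else 0)"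
    by (rule sum.swap)
  also have "(\<Sum>i<n. \<Sum>j<n. if \<pi> i < \<pi> j \<and> s (i, j) then \<sigma> i j else 0) +
      (\<Sum>i<n. \<Sum>j<n. if \<pi> i < \<pi> j \<and> \<not> s (i, j) then \<sigma> j i else 0) =
      (\<Sum>i<n. \<Sum>j<n. if \<pi> i < \<pi> j then \<sigma> i j * coin_sign s (i, j) else 0)"
    unfolding sum.distrib[symmetric]
  proof (intro sum.cong refl)
    fix i j
    show "(if \<pi> i < \<pi> j \<and> s (i, j) then \<sigma> i j else 0) +
        (if \<pi> i < \<pi> j \<and> \<not> s (i, j) then \<sigma> j i else 0) =
        (if \<pi> i < \<pi> j then \<sigma> i j * coin_sign s (i, j) else 0)"
      by (cases "s (i, j)") (simp_all add: coin_sign_def flip[of i j])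
  qed
  finally show ?thesis unfolding \<sigma> sum_ordered_pairs by (simp only: fst_conv snd_conv)
qed

text \<open>Taking \<open>g\<close> to be the coin signs yields the score of \<open>i\<close>, and
  taking it constant yields the mean score.\<close>

lemma sum_incident:
  fixes g :: "nat \<times> nat \<Rightarrow> real"
  assumes i: "i < n"
  shows "(\<Sum>e\<in>ordered_pairs n \<pi>. (of_bool (fst e = i) - of_bool (snd e = i)) * g e) =
    (\<Sum>k<n. if \<pi> i < \<pi> k then g (i, k) else if \<pi> k < \<pi> i then - g (k, i) else 0)"
proof -
  have "(\<Sum>e\<in>ordered_pairs n \<pi>. (of_bool (fst e = i) - of_bool (snd e = i)) * g e) =
      (\<Sum>e\<in>ordered_pairs n \<pi>. (if fst e = i then g e else 0) - (if snd e = i then g e else 0))"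
    by (intro sum.cong refl) simp
  also have "\<dots> = (\<Sum>e\<in>ordered_pairs n \<pi>. if fst e = i then g e else 0) -
      (\<Sum>e\<in>ordered_pairs n \<pi>. if snd e = i then g e else 0)"
    by (rule sum_subtractf)
  also have "(\<Sum>e\<in>ordered_pairs n \<pi>. if fst e = i then g e else 0) =
      (\<Sum>a<n. \<Sum>k<n. if a = i then (if \<pi> i < \<pi> k then g (i, k) else 0) else 0)"
    unfolding sum_ordered_pairs by (intro sum.cong refl) simp
  also have "\<dots> = (\<Sum>a<n. if a = i then \<Sum>k<n. if \<pi> i < \<pi> k then g (i, k) else 0 else 0)"
    by (intro sum.cong refl) simp
  also have "\<dots> = (\<Sum>k<n. if \<pi> i < \<pi> k then g (i, k) else 0)" using i by simp
  also have "(\<Sum>e\<in>ordered_pairs n \<pi>. if snd e = i then g e else 0) =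
      (\<Sum>k<n. \<Sum>b<n. if b = i then (if \<pi> k < \<pi> i then g (k, i) else 0) else 0)"
    unfolding sum_ordered_pairs by (intro sum.cong refl) simp
  also have "\<dots> = (\<Sum>k<n. if \<pi> k < \<pi> i then g (k, i) else 0)" using i by simp
  finally show ?thesis unfolding sum_subtractf[symmetric]
    by (simp only:) (intro sum.cong refl, simp)
qed

lemma sum_rank_signs:
  assumes "p < n"
  shows "(\<Sum>k<n. if p < k then 1 else if k < p then - 1 else (0 :: real)) = real n - 1 - 2 * real p"
  using assms
proof (induction n)
  case (Suc n)
  show ?case
  proof (cases "p = n")
    case True
    have "(\<Sum>k<n. if p < k then 1 else if k < p then - 1 else (0 :: real)) = (\<Sum>k<n. - 1)"
      by (intro sum.cong refl) (simp add: True)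
    then show ?thesis by (simp add: True)
  next
    case False
    then show ?thesis using Suc by simp
  qed
qed simp

text \<open>The left-hand side is the score of \<open>i\<close>, wins minus losses; the summand 1 is there because the count
  includes the diagonal.\<close>

lemma row_count_planted_matrix:
  assumes \<pi>: "\<pi> permutes {..<n}" and i: "i < n"
  shows "real n + 1 - 2 * (\<Sum>k<n. of_bool (planted_matrix n \<pi> s $$ (i, k) \<le> 0)) =
    (\<Sum>e\<in>ordered_pairs n \<pi>. (of_bool (fst e = i) - of_bool (snd e = i)) * noise \<mu> s e)
    + \<mu> * (real n - 1 - 2 * real (\<pi> i))"
proof -
  let ?\<delta> = "\<lambda>e. of_bool (fst e = i) - of_bool (snd e = i) :: real"
  have inj: "\<pi> k = \<pi> i \<longleftrightarrow> k = i" for k using permutes_inj[OF \<pi>] by (auto dest: injD)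
  have "(\<Sum>e\<in>ordered_pairs n \<pi>. ?\<delta> e * coin_sign s e) =
      (\<Sum>k<n. if \<pi> i < \<pi> k then coin_sign s (i, k) else if \<pi> k < \<pi> i then - coin_sign s (k, i) else 0)"
    by (rule sum_incident[OF i])
  \<comment> \<open>Off the diagonal, 1 - 2 or 1 - 0 is the sign of the entry; on it the entry 0 is
    counted, and 1 + 1 - 2 = 0.\<close>
  also have "\<dots> = (\<Sum>k<n. (1 + (if k = i then 1 else 0)) -
      2 * of_bool (planted_matrix n \<pi> s $$ (i, k) \<le> 0))"
  proof (intro sum.cong refl)
    fix k assume "k \<in> {..<n}"
    then show "(if \<pi> i < \<pi> k then coin_sign s (i, k) else if \<pi> k < \<pi> i then - coin_sign s (k, i) else 0) =
        (1 + (if k = i then 1 else 0)) - 2 * of_bool (planted_matrix n \<pi> s $$ (i, k) \<le> 0)"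
      using i inj[of k]
      by (cases "\<pi> i" "\<pi> k" rule: linorder_cases) (auto simp: planted_matrix_def coin_sign_def)
  qed
  also have "\<dots> = real n + 1 - 2 * (\<Sum>k<n. of_bool (planted_matrix n \<pi> s $$ (i, k) \<le> 0))"
    using i by (simp add: sum_subtractf sum.distrib sum_distrib_left del: sum_of_bool_eq)
  finally have c: "(\<Sum>e\<in>ordered_pairs n \<pi>. ?\<delta> e * coin_sign s e) =
    real n + 1 - 2 * (\<Sum>k<n. of_bool (planted_matrix n \<pi> s $$ (i, k) \<le> 0))" .
  have "(\<Sum>e\<in>ordered_pairs n \<pi>. ?\<delta> e * \<mu>) =
      (\<Sum>k<n. if \<pi> i < \<pi> k then \<mu> else if \<pi> k < \<pi> i then - \<mu> else 0)"
    by (rule sum_incident[OF i])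
  also have "\<dots> = (\<Sum>k<n. \<mu> * (if \<pi> i < \<pi> k then 1 else if \<pi> k < \<pi> i then - 1 else 0))"
    by (intro sum.cong refl) simp
  also have "\<dots> = \<mu> * (\<Sum>k<n. if \<pi> i < \<pi> k then 1 else if \<pi> k < \<pi> i then - 1 else 0)"
    by (rule sum_distrib_left[symmetric])
  \<comment> \<open>As \<open>\<pi>\<close> is a bijection, the mean score depends only on the
    position \<open>\<pi> i\<close>: later vertices count 1 and earlier ones -1.\<close>
  also have "(\<Sum>k<n. if \<pi> i < \<pi> k then 1 else if \<pi> k < \<pi> i then - 1 else 0) =
      (\<Sum>k<n. if \<pi> i < k then 1 else if k < \<pi> i then - 1 else (0 :: real))"
    by (rule sum.reindex_bij_betw[OF permutes_imp_bij[OF \<pi>]])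
  also have "\<dots> = real n - 1 - 2 * real (\<pi> i)"
    using permutes_in_image[OF \<pi>, of i] i by (intro sum_rank_signs) simp
  finally have m: "(\<Sum>e\<in>ordered_pairs n \<pi>. ?\<delta> e * \<mu>) = \<mu> * (real n - 1 - 2 * real (\<pi> i))" .
  have "(\<Sum>e\<in>ordered_pairs n \<pi>. ?\<delta> e * noise \<mu> s e) =
      (\<Sum>e\<in>ordered_pairs n \<pi>. ?\<delta> e * coin_sign s e) - (\<Sum>e\<in>ordered_pairs n \<pi>. ?\<delta> e * \<mu>)"
    unfolding noise_eq right_diff_distrib sum_subtractf ..
  then show ?thesis unfolding c m by simp
qed

section \<open>Near-optimality of the ranking\<close>

text \<open>Adding up the noise of the single vertices of \<open>B\<close> gives the form bounded by
  \<open>noise_vertex_sets\<close>; edges inside \<open>B\<close> cancel.\<close>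

lemma sum_incident_vertex_set:
  fixes g :: "nat \<times> nat \<Rightarrow> real"
  assumes "finite B"
  shows "(\<Sum>i\<in>B. \<Sum>e\<in>E. (of_bool (fst e = i) - of_bool (snd e = i)) * g e) =
    (\<Sum>e\<in>E. (of_bool (fst e \<in> B) - of_bool (snd e \<in> B)) * g e)"
proof -
  have one: "(\<Sum>i\<in>B. of_bool (a = i)) = (of_bool (a \<in> B) :: real)" for a
  proof -
    have "(\<Sum>i\<in>B. of_bool (a = i)) = (\<Sum>i\<in>B. if a = i then 1 else 0 :: real)"
      by (intro sum.cong refl) simp
    then show ?thesis using assms by simp
  qed
  have "(\<Sum>i\<in>B. \<Sum>e\<in>E. (of_bool (fst e = i) - of_bool (snd e = i)) * g e) =
      (\<Sum>e\<in>E. \<Sum>i\<in>B. (of_bool (fst e = i) - of_bool (snd e = i)) * g e)"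
    by (rule sum.swap)
  also have "\<dots> = (\<Sum>e\<in>E. (of_bool (fst e \<in> B) - of_bool (snd e \<in> B)) * g e)"
    by (simp only: sum_distrib_right[symmetric] sum_subtractf one)
  finally show ?thesis .
qed

lemma card_ahead_within_le:
  fixes k :: real
  assumes "inj_on \<pi> A" "0 < k"
  shows "real (card {j\<in>A. p < \<pi> j \<and> real (\<pi> j) < real p + k}) \<le> k"
proof -
  let ?S = "{j\<in>A. p < \<pi> j \<and> real (\<pi> j) < real p + k}"
  have "\<pi> ` ?S \<subseteq> {p<..p + nat \<lfloor>k\<rfloor>}"
  proof (rule image_subsetI)
    fix j assume "j \<in> ?S"
    then have "p < \<pi> j" "real (\<pi> j) < real p + k" by simp_all
    then have "real (\<pi> j - p) \<le> k" by (simp add: of_nat_diff)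
    then have "\<pi> j - p \<le> nat \<lfloor>k\<rfloor>" by (rule le_nat_floor)
    then show "\<pi> j \<in> {p<..p + nat \<lfloor>k\<rfloor>}" using \<open>p < \<pi> j\<close> by simp
  qed
  then have "card (\<pi> ` ?S) \<le> card {p<..p + nat \<lfloor>k\<rfloor>}" by (intro card_mono) simp_all
  moreover have "inj_on \<pi> ?S" using assms(1) by (rule inj_on_subset) auto
  ultimately have "card ?S \<le> nat \<lfloor>k\<rfloor>" by (simp add: card_image)
  then show ?thesis using assms(2) by linarith
qed

text \<open>If the ranking inverts a pair, then either the two vertices are within \<open>k\<close> positions, or the
  noise moved the score of one of them by at least half the gap between the two mean scores. The
  hypothesis, applied to the set of all vertices whose noise is large and of one sign, shows that
  there are few of them.\<close>

lemma card_discordant_le: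
  fixes \<gamma> k :: real
  assumes \<pi>: "\<pi> permutes {..<n}" and \<gamma>: "0 < \<gamma>" and k: "0 < k"
    and noise: "\<And>B. B \<subseteq> {..<n} \<Longrightarrow> \<bar>\<Sum>e\<in>ordered_pairs n \<pi>.
      (of_bool (fst e \<in> B) - of_bool (snd e \<in> B)) * noise (2 * \<gamma>) s e\<bar> \<le> 2 * real n powr (3/2)"
  defines "\<rho> \<equiv> rank_alg (planted_matrix n \<pi> s)"
  shows "real (card {e\<in>ordered_pairs n \<pi>. \<rho> (snd e) < \<rho> (fst e)}) \<le>
    real n * k + 2 * real n * (real n powr (3/2) / (\<gamma> * k))"
proof -
  let ?E = "ordered_pairs n \<pi>" and ?T = "planted_matrix n \<pi> s"
  define W where "W = (\<lambda>i. \<Sum>e\<in>?E. (of_bool (fst e = i) - of_bool (snd e = i)) * noise (2 * \<gamma>) s e)"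
  define Up where "Up = {i\<in>{..<n}. 2 * \<gamma> * k \<le> W i}"
  define Down where "Down = {i\<in>{..<n}. 2 * \<gamma> * k \<le> - W i}"
  define Near where "Near = (SIGMA i:{..<n}. {j\<in>{..<n}. \<pi> i < \<pi> j \<and> real (\<pi> j) < real (\<pi> i) + k})"
  have dim: "dim_row ?T = n" by (simp add: planted_matrix_def)
  have finB: "finite Up" "finite Down" "Up \<subseteq> {..<n}" "Down \<subseteq> {..<n}"
    by (auto simp: Up_def Down_def)
  have sumW: "\<bar>\<Sum>i\<in>B. W i\<bar> \<le> 2 * real n powr (3/2)" if "finite B" "B \<subseteq> {..<n}" for B
    unfolding W_def sum_incident_vertex_set[OF that(1)] by (rule noise[OF that(2)])
  have cUp: "real (card Up) \<le> real n powr (3/2) / (\<gamma> * k)"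
  proof -
    have "real (card Up) * (2 * \<gamma> * k) \<le> (\<Sum>i\<in>Up. W i)"
      by (rule sum_bounded_below) (simp add: Up_def)
    then have "real (card Up) * (2 * \<gamma> * k) \<le> 2 * real n powr (3/2)"
      using sumW[of Up] finB by linarith
    then show ?thesis using \<gamma> k by (simp add: pos_le_divide_eq mult_ac)
  qed
  have cDown: "real (card Down) \<le> real n powr (3/2) / (\<gamma> * k)"
  proof -
    have "real (card Down) * (2 * \<gamma> * k) \<le> (\<Sum>i\<in>Down. - W i)"
      by (rule sum_bounded_below) (simp add: Down_def)
    then have "real (card Down) * (2 * \<gamma> * k) \<le> 2 * real n powr (3/2)"
      unfolding sum_negf using sumW[of Down] finB by linarith
    then show ?thesis using \<gamma> k by (simp add: pos_le_divide_eq mult_ac)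
  qed
  have cNear: "real (card Near) \<le> real n * k"
  proof -
    have "real (card Near) =
        (\<Sum>i<n. real (card {j\<in>{..<n}. \<pi> i < \<pi> j \<and> real (\<pi> j) < real (\<pi> i) + k}))"
      unfolding Near_def by (subst card_SigmaI) simp_all
    also have "\<dots> \<le> (\<Sum>i<n. k)"
      by (intro sum_mono card_ahead_within_le permutes_inj_on[OF \<pi>] k)
    finally show ?thesis by simp
  qed
  have "{e\<in>?E. \<rho> (snd e) < \<rho> (fst e)} \<subseteq> Near \<union> ({..<n} \<times> Up) \<union> (Down \<times> {..<n})"
  proof
    fix e assume e: "e \<in> {e\<in>?E. \<rho> (snd e) < \<rho> (fst e)}"
    obtain i j where ij: "e = (i, j)" by (cases e)
    have i: "i < n" and j: "j < n" and lt: "\<pi> i < \<pi> j" and disc: "\<rho> j < \<rho> i"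
      using e by (auto simp: ij ordered_pairs_def)
    have "(\<Sum>k<n. of_bool (?T $$ (j, k) \<le> 0) :: int) \<le> (\<Sum>k<n. of_bool (?T $$ (i, k) \<le> 0))"
      by (rule rank_alg_less_imp[OF dim i j disc[unfolded \<rho>_def]])
    then have "real_of_int (\<Sum>k<n. of_bool (?T $$ (j, k) \<le> 0)) \<le>
        real_of_int (\<Sum>k<n. of_bool (?T $$ (i, k) \<le> 0))"
      by (simp only: of_int_le_iff)
    then have "(\<Sum>k<n. of_bool (?T $$ (j, k) \<le> 0) :: real) \<le> (\<Sum>k<n. of_bool (?T $$ (i, k) \<le> 0))"
      by (simp only: of_int_sum of_int_of_bool)
    \<comment> \<open>Ranking \<open>j\<close> before \<open>i\<close> means that the score of
      \<open>j\<close> is at least that of \<open>i\<close>; each score is split into noise and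
      mean.\<close>
    then have "W i + 2 * \<gamma> * (real n - 1 - 2 * real (\<pi> i)) \<le> W j + 2 * \<gamma> * (real n - 1 - 2 * real (\<pi> j))"
      using row_count_planted_matrix[OF \<pi> i, of s "2 * \<gamma>"]
        row_count_planted_matrix[OF \<pi> j, of s "2 * \<gamma>"] unfolding W_def by linarith
    then have gap: "4 * \<gamma> * (real (\<pi> j) - real (\<pi> i)) \<le> W j - W i" by (simp add: algebra_simps)
    show "e \<in> Near \<union> ({..<n} \<times> Up) \<union> (Down \<times> {..<n})"
    proof (cases "real (\<pi> j) < real (\<pi> i) + k")
      case True
      then show ?thesis using i j lt by (simp add: ij Near_def)
    next
      case False
      then have "4 * \<gamma> * k \<le> 4 * \<gamma> * (real (\<pi> j) - real (\<pi> i))"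
        using \<gamma> by (intro mult_left_mono) simp_all
      with gap have "2 * \<gamma> * k \<le> W j \<or> 2 * \<gamma> * k \<le> - W i" by linarith
      then show ?thesis using i j by (auto simp: ij Up_def Down_def)
    qed
  qed
  then have "card {e\<in>?E. \<rho> (snd e) < \<rho> (fst e)} \<le> card (Near \<union> ({..<n} \<times> Up) \<union> (Down \<times> {..<n}))"
    using finB by (intro card_mono) (simp_all add: Near_def)
  also have "\<dots> \<le> card Near + card ({..<n} \<times> Up) + card (Down \<times> {..<n})"
    by (rule order_trans[OF card_Un_le add_right_mono[OF card_Un_le]])
  finally have "card {e\<in>?E. \<rho> (snd e) < \<rho> (fst e)} \<le> card Near + n * card Up + n * card Down"
    by (simp add: card_cartesian_product mult.commute)
  then have "real (card {e\<in>?E. \<rho> (snd e) < \<rho> (fst e)}) \<le> real (card Near + n * card Up + n * card Down)"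
    by (rule of_nat_mono)
  also have "\<dots> = real (card Near) + real n * real (card Up) + real n * real (card Down)"
    by simp
  also have "\<dots> \<le> real n * k + real n * (real n powr (3/2) / (\<gamma> * k)) + real n * (real n powr (3/2) / (\<gamma> * k))"
    by (intro add_mono mult_left_mono cNear cUp cDown) simp_all
  finally show ?thesis by simp
qed

lemma sum_sgn_ordered_pairs:
  assumes \<rho>: "\<rho> permutes {..<n}"
  shows "(\<Sum>e\<in>ordered_pairs n \<pi>. sgn (real (\<rho> (snd e)) - real (\<rho> (fst e)))) =
    real (card (ordered_pairs n \<pi>)) - 2 * real (card {e\<in>ordered_pairs n \<pi>. \<rho> (snd e) < \<rho> (fst e)})"
proof -
  let ?E = "ordered_pairs n \<pi>"
  have "(\<Sum>e\<in>?E. sgn (real (\<rho> (snd e)) - real (\<rho> (fst e)))) =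
      (\<Sum>e\<in>?E. 1 - 2 * of_bool (\<rho> (snd e) < \<rho> (fst e)))"
  proof (intro sum.cong refl)
    fix e assume "e \<in> ?E"
    then have "fst e \<noteq> snd e" by (auto simp: ordered_pairs_def)
    then have "\<rho> (fst e) \<noteq> \<rho> (snd e)" by (simp add: inj_eq[OF permutes_inj[OF \<rho>]])
    then show "sgn (real (\<rho> (snd e)) - real (\<rho> (fst e))) = 1 - 2 * of_bool (\<rho> (snd e) < \<rho> (fst e))"
      by (cases "\<rho> (fst e)" "\<rho> (snd e)" rule: linorder_cases) simp_all
  qed
  also have "\<dots> = real (card ?E) - 2 * (\<Sum>e\<in>?E. of_bool (\<rho> (snd e) < \<rho> (fst e)))"
    by (simp only: sum_subtractf sum_distrib_left[symmetric]) simp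
  also have "(\<Sum>e\<in>?E. of_bool (\<rho> (snd e) < \<rho> (fst e)) :: real) =
      real (card {e\<in>?E. \<rho> (snd e) < \<rho> (fst e)})"
    using finite_ordered_pairs[of n \<pi>] by (simp add: Int_def)
  finally show ?thesis .
qed

text \<open>Put y = \<gamma> n^2 and A = 2 \<gamma> |E|, with E the set of ordered pairs, so that
  n^(3/2) = y / x and A >= y / 2. The optimum is at most A + 44 y / x, and the ranking attains at
  least A - 44 y / x - 12 y / sqrt x. The difference 88 y / x + 12 y / sqrt x equals \<epsilon> y /
  2, which explains 176 and 24. The bound \<epsilon> <= 1 keeps the factor in front of the optimum
  nonnegative.\<close>

lemma rank_alg_near_optimal:
  fixes \<gamma> :: real
  assumes \<pi>: "\<pi> permutes {..<n}" and n: "2 \<le> n" and \<gamma>: "0 < \<gamma>"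
    and sets: "\<And>B. B \<subseteq> {..<n} \<Longrightarrow> \<bar>\<Sum>e\<in>ordered_pairs n \<pi>.
      (of_bool (fst e \<in> B) - of_bool (snd e \<in> B)) * noise (2 * \<gamma>) s e\<bar> \<le> 2 * real n powr (3/2)"
    and orderings: "\<And>\<rho>. \<rho> permutes {..<n} \<Longrightarrow> \<bar>\<Sum>e\<in>ordered_pairs n \<pi>.
      sgn (real (\<rho> (snd e)) - real (\<rho> (fst e))) * noise (2 * \<gamma>) s e\<bar> \<le> 44 * real n powr (3/2)"
  defines "x \<equiv> \<gamma> * sqrt (real n)" and "T \<equiv> planted_matrix n \<pi> s"
  defines "\<epsilon> \<equiv> 176 / x + 24 / sqrt x"
  assumes \<epsilon>: "\<epsilon> \<le> 1"
  shows "(1 - \<epsilon>) * real_of_int (MAX \<rho>\<in>{\<rho>. \<rho> permutes {..<n}}. align \<rho> T)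
    \<le> real_of_int (align (rank_alg T) T)"
proof -
  let ?E = "ordered_pairs n \<pi>"
  define disc where "disc = (\<lambda>\<rho> :: nat \<Rightarrow> nat. real (card {e\<in>?E. \<rho> (snd e) < \<rho> (fst e)}))"
  have x: "0 < x" using n \<gamma> by (simp add: x_def)
  have n32: "real n powr (3/2) = real n * sqrt (real n)"
  proof -
    have "real n powr (1 + 1/2) = real n powr 1 * real n powr (1/2)" by (rule powr_add)
    then show ?thesis by (simp add: powr_half_sqrt)
  qed
  have N: "real n powr (3/2) = \<gamma> * (real n)\<^sup>2 / x"
    using n \<gamma> by (simp add: n32 x_def field_simps power2_eq_square)
  have align_eq: "real_of_int (align \<rho> T) = 2 * \<gamma> * (real (card ?E) - 2 * disc \<rho>) +
      (\<Sum>e\<in>?E. sgn (real (\<rho> (snd e)) - real (\<rho> (fst e))) * noise (2 * \<gamma>) s e)"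
    if "\<rho> permutes {..<n}" for \<rho>
  proof -
    have "(\<Sum>e\<in>?E. sgn (real (\<rho> (snd e)) - real (\<rho> (fst e))) * noise (2 * \<gamma>) s e) =
        real_of_int (align \<rho> T) - (\<Sum>e\<in>?E. sgn (real (\<rho> (snd e)) - real (\<rho> (fst e))) * (2 * \<gamma>))"
      unfolding T_def align_planted_matrix noise_eq right_diff_distrib sum_subtractf ..
    also have "(\<Sum>e\<in>?E. sgn (real (\<rho> (snd e)) - real (\<rho> (fst e))) * (2 * \<gamma>)) =
        2 * \<gamma> * (real (card ?E) - 2 * disc \<rho>)"
      unfolding sum_distrib_right[symmetric] sum_sgn_ordered_pairs[OF that] disc_def
      by (rule mult.commute)
    finally show ?thesis by simp
  qed
  define \<rho>0 where "\<rho>0 = rank_alg T"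
  have \<rho>0: "\<rho>0 permutes {..<n}"
    unfolding \<rho>0_def by (rule rank_alg_permutes) (simp add: T_def planted_matrix_def)
  have "disc \<rho>0 \<le> 3 * (real n)\<^sup>2 / sqrt x"
  proof -
    \<comment> \<open>This choice of the distance balances the close pairs against the pairs with
      large noise: the two terms become n^2 / sqrt x and twice that.\<close>
    have k: "0 < real n / sqrt x" using n x by simp
    have "disc \<rho>0 \<le> real n * (real n / sqrt x) + 2 * real n * (real n powr (3/2) / (\<gamma> * (real n / sqrt x)))"
      unfolding disc_def \<rho>0_def T_def by (rule card_discordant_le[OF \<pi> \<gamma> k sets])
    also have "real n powr (3/2) / (\<gamma> * (real n / sqrt x)) = real n / sqrt x"
    proof -
      have "real n powr (3/2) / (\<gamma> * (real n / sqrt x)) = real n * sqrt x / x"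
        using n \<gamma> x by (simp add: N field_simps power2_eq_square)
      also have "\<dots> = real n / sqrt x" using x by (simp add: field_simps)
      finally show ?thesis .
    qed
    finally show ?thesis by (simp add: power2_eq_square)
  qed
  then have "4 * \<gamma> * disc \<rho>0 \<le> 4 * \<gamma> * (3 * (real n)\<^sup>2 / sqrt x)"
    using \<gamma> by (intro mult_left_mono) simp_all
  then have lower: "2 * \<gamma> * real (card ?E) - (12 * (\<gamma> * (real n)\<^sup>2) / sqrt x + 44 * (\<gamma> * (real n)\<^sup>2 / x))
      \<le> real_of_int (align \<rho>0 T)"
    using align_eq[OF \<rho>0] orderings[OF \<rho>0] unfolding N by (simp add: algebra_simps)
  have upper: "real_of_int (align \<rho> T) \<le> 2 * \<gamma> * real (card ?E) + 44 * (\<gamma> * (real n)\<^sup>2 / x)"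
    if "\<rho> permutes {..<n}" for \<rho>
  proof -
    have "0 \<le> \<gamma> * disc \<rho>" using \<gamma> by (simp add: disc_def)
    then show ?thesis
      using align_eq[OF that] orderings[OF that] unfolding N by (simp add: algebra_simps)
  qed
  define A where "A = 2 * \<gamma> * real (card ?E)"
  define y where "y = \<gamma> * (real n)\<^sup>2"
  have A: "y / 2 \<le> A"
  proof -
    \<comment> \<open>From \<open>2 \<le> n\<close> it follows that n^2 - n is at least n^2 /
      2.\<close>
    have "2 * real n \<le> (real n)\<^sup>2" using n by (simp add: power2_eq_square)
    then have "(real n)\<^sup>2 / 2 \<le> 2 * real (card ?E)"
      using card_ordered_pairs[OF \<pi>] by simp
    then have "\<gamma> * ((real n)\<^sup>2 / 2) \<le> \<gamma> * (2 * real (card ?E))"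
      using \<gamma> by (intro mult_left_mono) simp_all
    then show ?thesis by (simp add: A_def y_def mult_ac)
  qed
  have y: "0 \<le> y" using \<gamma> by (simp add: y_def)
  have \<epsilon>0: "0 \<le> \<epsilon>" using x by (simp add: \<epsilon>_def)
  let ?S = "{\<rho>. \<rho> permutes {..<n}}"
  have "(MAX \<rho>\<in>?S. align \<rho> T) \<in> (\<lambda>\<rho>. align \<rho> T) ` ?S"
    using \<rho>0 by (intro Max_in finite_imageI finite_permutations) auto
  then obtain \<rho> where \<rho>: "\<rho> permutes {..<n}" "(MAX \<rho>\<in>?S. align \<rho> T) = align \<rho> T" by blast
  have "(1 - \<epsilon>) * real_of_int (align \<rho> T) \<le> (1 - \<epsilon>) * (A + 44 * (y / x))"
    using \<epsilon> upper[OF \<rho>(1)] by (intro mult_left_mono) (simp_all add: A_def y_def)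
  also have "\<dots> \<le> A - (12 * y / sqrt x + 44 * (y / x))"
  proof -
    define w where "w = A + 44 * (y / x)"
    have "0 \<le> 44 * (y / x)" using y x by simp
    then have "y / 2 \<le> w" using A by (simp add: w_def)
    then have "\<epsilon> * (y / 2) \<le> \<epsilon> * w" using \<epsilon>0 by (rule mult_left_mono)
    moreover have "\<epsilon> * (y / 2) = 12 * y / sqrt x + 88 * (y / x)"
      by (simp add: \<epsilon>_def algebra_simps)
    ultimately have "12 * y / sqrt x + 88 * (y / x) \<le> \<epsilon> * w" by simp
    then have "w - \<epsilon> * w \<le> A - (12 * y / sqrt x + 44 * (y / x))" by (simp add: w_def)
    then show ?thesis unfolding w_def[symmetric] by (simp add: left_diff_distrib)
  qed
  also have "\<dots> \<le> real_of_int (align \<rho>0 T)"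
    using lower by (simp only: A_def y_def)
  finally show ?thesis by (simp only: \<rho>(2) \<rho>0_def)
qed

section \<open>Averaging over the hidden permutation, and the limit\<close>

lemma prob_bind_pmf_ge:
  assumes "\<And>x. x \<in> set_pmf M \<Longrightarrow> c \<le> measure_pmf.prob (f x) X"
  shows "c \<le> measure_pmf.prob (bind_pmf M f) X"
proof -
  have "ennreal c = (\<integral>\<^sup>+x. ennreal c \<partial>measure_pmf M)"
    by (simp add: measure_pmf.emeasure_space_1[simplified])
  also have "\<dots> \<le> (\<integral>\<^sup>+x. emeasure (measure_pmf (f x)) X \<partial>measure_pmf M)"
    by (intro nn_integral_mono_AE)
       (simp add: AE_measure_pmf_iff measure_pmf.emeasure_eq_measure ennreal_leI assms)
  also have "\<dots> = emeasure (measure_pmf (bind_pmf M f)) X" by (rule emeasure_bind_pmf[symmetric])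
  also have "\<dots> = ennreal (measure_pmf.prob (bind_pmf M f) X)"
    by (rule measure_pmf.emeasure_eq_measure)
  finally show ?thesis by (simp add: ennreal_le_iff)
qed

text \<open>The vertex sets fail with probability at most 2 e^(-n) and the orderings with at most 2
  n e^(-n), for every fixed hidden permutation. Off these two events near-optimality is
  deterministic.\<close>

lemma planted_model_near_optimal:
  fixes \<gamma> :: real
  assumes n: "2 \<le> n" and \<gamma>: "0 < \<gamma>" "\<gamma> \<le> 1/2"
    and \<epsilon>: "176 / (\<gamma> * sqrt (real n)) + 24 / sqrt (\<gamma> * sqrt (real n)) \<le> 1" (is "?\<epsilon> \<le> 1")
  shows "1 - (2 + 2 * real n) * exp (- real n) \<le> measure_pmf.prob (planted_model n \<gamma>)
    {T. real_of_int (align (rank_alg T) T) \<ge>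
      (1 - ?\<epsilon>) * real_of_int (MAX \<rho>\<in>{\<rho>. \<rho> permutes {..<n}}. align \<rho> T)}"
    (is "_ \<le> measure_pmf.prob _ ?X")
  unfolding planted_model_eq
proof (rule prob_bind_pmf_ge)
  fix \<pi> assume "\<pi> \<in> set_pmf (pmf_of_set {\<pi>. \<pi> permutes {..<n}})"
  moreover have "{\<pi>. \<pi> permutes {..<n}} \<noteq> {}" using permutes_id by blast
  moreover have "finite {\<pi>. \<pi> permutes {..<n}}" by (simp add: finite_permutations)
  ultimately have \<pi>: "\<pi> permutes {..<n}" by (simp add: set_pmf_of_set)
  let ?E = "ordered_pairs n \<pi>"
  let ?M = "Pi_pmf ?E False (\<lambda>_. bernoulli_pmf (1/2 + \<gamma>))"
  define B1 where "B1 = {s. \<exists>B\<in>Pow {..<n}. 2 * real n powr (3/2) \<le>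
      \<bar>\<Sum>e\<in>?E. (of_bool (fst e \<in> B) - of_bool (snd e \<in> B)) * noise (2 * \<gamma>) s e\<bar>}"
  define B2 where "B2 = {s. \<exists>\<rho>. \<rho> permutes {..<n} \<and> 44 * real n powr (3/2) <
      \<bar>\<Sum>e\<in>?E. sgn (real (\<rho> (snd e)) - real (\<rho> (fst e))) * noise (2 * \<gamma>) s e\<bar>}"
  have p: "1/2 + \<gamma> \<in> {0..1}" and n0: "0 < n" using \<gamma> n by simp_all
  have \<mu>: "2 * (1/2 + \<gamma>) - 1 = 2 * \<gamma>" by simp
  have "measure_pmf.prob ?M (B1 \<union> B2) \<le> measure_pmf.prob ?M B1 + measure_pmf.prob ?M B2"
    by (rule measure_Un_le) simp_all
  also have "\<dots> \<le> 2 * exp (- real n) + real n * (2 * exp (- real n))"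
    unfolding B1_def B2_def
    by (intro add_mono noise_vertex_sets[OF ordered_pairs_subset p n0, unfolded \<mu>]
        noise_orderings[OF ordered_pairs_subset p n0, unfolded \<mu>])
  finally have bad: "measure_pmf.prob ?M (B1 \<union> B2) \<le> (2 + 2 * real n) * exp (- real n)"
    by (simp add: algebra_simps)
  have "- (B1 \<union> B2) \<subseteq> planted_matrix n \<pi> -` ?X"
  proof
    fix s assume s: "s \<in> - (B1 \<union> B2)"
    have sets: "\<bar>\<Sum>e\<in>?E. (of_bool (fst e \<in> B) - of_bool (snd e \<in> B)) * noise (2 * \<gamma>) s e\<bar>
        \<le> 2 * real n powr (3/2)" if "B \<subseteq> {..<n}" for B
    proof (rule ccontr)
      assume "\<not> ?thesis"
      then have "s \<in> B1"
        unfolding B1_def mem_Collect_eq not_le by (intro bexI[of _ B] less_imp_le) (simp_all add: that)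
      then show False using s by simp
    qed
    have orderings: "\<bar>\<Sum>e\<in>?E. sgn (real (\<rho> (snd e)) - real (\<rho> (fst e))) * noise (2 * \<gamma>) s e\<bar>
        \<le> 44 * real n powr (3/2)" if "\<rho> permutes {..<n}" for \<rho>
    proof (rule ccontr)
      assume "\<not> ?thesis"
      with that have "s \<in> B2"
        unfolding B2_def mem_Collect_eq not_le by (intro exI conjI)
      then show False using s by simp
    qed
    show "s \<in> planted_matrix n \<pi> -` ?X"
      unfolding vimage_eq mem_Collect_eq
      by (rule rank_alg_near_optimal[OF \<pi> n \<gamma>(1) sets orderings \<epsilon>])
  qed
  then have "measure_pmf.prob ?M (- (B1 \<union> B2)) \<le> measure_pmf.prob ?M (planted_matrix n \<pi> -` ?X)"
    by (intro measure_pmf.finite_measure_mono) simp_all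
  moreover have "measure_pmf.prob ?M (- (B1 \<union> B2)) = 1 - measure_pmf.prob ?M (B1 \<union> B2)"
    using measure_pmf.prob_compl[of "B1 \<union> B2" ?M] by (simp add: Compl_eq_Diff_UNIV)
  ultimately show "1 - (2 + 2 * real n) * exp (- real n)
      \<le> measure_pmf.prob (map_pmf (planted_matrix n \<pi>) ?M) ?X"
    unfolding measure_map_pmf using bad by linarith
qed

theorem theorem2p12:
  fixes \<gamma> :: "nat \<Rightarrow> real"
  assumes "\<And>n. 0 \<le> \<gamma> n" and "\<And>n. \<gamma> n \<le> 1/4"
    and "\<gamma> \<in> \<omega>(\<lambda>n. real n powr (-1/2))"
  shows "\<exists>A. poly_time_algorithm A \<and>
    (\<exists>\<epsilon> :: nat \<Rightarrow> real. \<epsilon> \<longlonglongrightarrow> 0 \<and>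
      (\<lambda>n. measure_pmf.prob (planted_model n (\<gamma> n))
         {T. real_of_int (align (A T) T) \<ge>
             (1 - \<epsilon> n) * real_of_int (MAX \<rho>\<in>{\<rho>. \<rho> permutes {..<n}}. align \<rho> T)})
      \<longlonglongrightarrow> 1)"
proof -
  define x where "x = (\<lambda>n. \<gamma> n * sqrt (real n))"
  define \<epsilon> where "\<epsilon> = (\<lambda>n. 176 / x n + 24 / sqrt (x n))"
  have x_top: "filterlim x at_top sequentially"
  proof (subst filterlim_at_top_gt[where c = 0], intro allI impI)
    fix Z :: real assume Z: "0 < Z"
    \<comment> \<open>For each \<open>Z\<close>, the growth hypothesis makes
      \<open>\<gamma> n\<close> eventually at least Z / sqrt n, and multiplying by sqrt n gives the
      claim.\<close>
    have "\<forall>\<^sub>F n in sequentially. Z * norm (real n powr (-1/2)) \<le> norm (\<gamma> n)"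
      using landau_omega.smallD[OF assms(3) Z] by simp
    then show "\<forall>\<^sub>F n in sequentially. Z \<le> x n"
      using eventually_gt_at_top[of 0]
    proof eventually_elim
      case (elim n)
      have "real n powr (-1/2) * sqrt (real n) = 1"
        using elim(2) by (simp add: powr_half_sqrt[symmetric] flip: powr_add)
      then have "Z = Z * norm (real n powr (-1/2)) * sqrt (real n)" by simp
      also have "\<dots> \<le> norm (\<gamma> n) * sqrt (real n)" by (intro mult_right_mono elim(1)) simp
      finally show ?case using assms(1)[of n] by (simp add: x_def)
    qed
  qed
  have \<epsilon>_lim: "\<epsilon> \<longlonglongrightarrow> 0"
  proof -
    have "((\<lambda>x :: real. 176 / x + 24 / sqrt x) \<longlongrightarrow> 0) at_top" by real_asymp
    then show ?thesis unfolding \<epsilon>_def using x_top by (rule filterlim_compose)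
  qed
  let ?P = "\<lambda>n. measure_pmf.prob (planted_model n (\<gamma> n))
    {T. real_of_int (align (rank_alg T) T) \<ge>
      (1 - \<epsilon> n) * real_of_int (MAX \<rho>\<in>{\<rho>. \<rho> permutes {..<n}}. align \<rho> T)}"
  have "?P \<longlonglongrightarrow> 1"
  proof (rule tendsto_sandwich[where h = "\<lambda>_. 1"])
    \<comment> \<open>The finite bound requires \<epsilon> <= 1 and \<gamma> > 0, both of which may
      fail for small \<open>n\<close> but hold eventually.\<close>
    have "\<forall>\<^sub>F n in sequentially. \<epsilon> n < 1" using \<epsilon>_lim by (rule order_tendstoD) simp
    moreover have "\<forall>\<^sub>F n in sequentially. 0 < x n"
      using x_top by (simp add: filterlim_at_top_dense)
    ultimately show "\<forall>\<^sub>F n in sequentially. 1 - (2 + 2 * real n) * exp (- real n) \<le> ?P n"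
      using eventually_ge_at_top[of 2]
    proof eventually_elim
      case (elim n)
      have "0 < \<gamma> n" using elim(2) assms(1)[of n] by (simp add: x_def zero_less_mult_iff)
      moreover have "\<gamma> n \<le> 1/2" using assms(2)[of n] by simp
      ultimately show ?case
        using planted_model_near_optimal[OF elim(3), of "\<gamma> n"] elim(1)
        unfolding \<epsilon>_def x_def by simp
    qed
    show "(\<lambda>n. 1 - (2 + 2 * real n) * exp (- real n)) \<longlonglongrightarrow> 1" by real_asymp
  qed simp_all
  then show ?thesis using poly_time_rank_alg \<epsilon>_lim by blast
qed

end
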